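(* Let $(n,d)$ be a pair of integers with $d\ge 0$ and $(n,d)\neq(0,0)$. There exist integers $0\le a\le b\le c$ with $a+b+c=d$ such that the linear system $|3M+nL|$ on the scroll $\mathbb{F}=\mathbb{F}(0,a,b,c)$ satisfies both conditions 1. the relative surface $B=\{z=t=0\}$ is not contained in the base locus of $|3M+nL|$; and, when $a=b$, a general member of $|3M+nL|$ does not contain a surface of the form $\{s=t=0\}$ where $s$ is some section of $\mathcal{O}_{\mathbb{F}}(M-bL)$; 2. the curve $\Gamma=\{y=z=t=0\}$ is contained in the base locus of $|3M+nL|$ with multiplicity at most one; that is, when $n<0$, a general member $X\in|3M+nL|$ is nonsingular generically along $\Gamma$; if and only if one of the following holds: (i) $n>0$; (ii) $n=-3k$ for an integer $k\ge 0$ and $d\ge 5k+1$; (iii) $n=-3k-1$ for an integer $k\ge 0$ and $d\ge 5k+3$; (iv) $n=-3k-2$ for an integer $k\ge 0$ and $d\ge 5k+4$.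
   Context: We work over $\mathbb{C}$. For integers $0\le a\le b\le c$, the scroll $\mathbb{F}(0,a,b,c)$ is the $\mathbb{P}^3$-bundle over $\mathbb{P}^1$ obtained as the quotient of $(\mathbb{C}^2\setminus\{0\})\times(\mathbb{C}^4\setminus\{0\})$, with coordinates $u,v$ and $x,y,z,t$, by the action of $\mathbb{C}^\times\times\mathbb{C}^\times$ given by $\lambda\colon(u,v,x,y,z,t)\mapsto(\lambda u,\lambda v,x,\lambda^{-a}y,\lambda^{-b}z,\lambda^{-c}t)$ and $\mu\colon(u,v,x,y,z,t)\mapsto(u,v,\mu x,\mu y,\mu z,\mu t)$. $L$ and $M$ are the line bundles (divisor classes) whose sections are the functions that are eigenfunctions for the characters $(\lambda,\mu)\mapsto\lambda$ and $(\lambda,\mu)\mapsto\mu$ respectively. Thus a section of $3M+nL$ is a polynomial $\sum \alpha_{ijkl}(u,v)\,x^iy^jz^kt^l$ with $i+j+k+l=3$ and $\alpha_{ijkl}$ homogeneous of degree $n+aj+bk+cl$. *)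

theory Defs
  imports "HOL-Analysis.Analysis"
begin

datatype coord = Cu | Cv | Cx | Cy | Cz | Ct

lemma UNIV_coord: "UNIV = {Cu, Cv, Cx, Cy, Cz, Ct}"
  using coord.exhaust by auto

instance coord :: finite
  by standard (simp add: UNIV_coord)

fun torus_act :: "int \<Rightarrow> int \<Rightarrow> int \<Rightarrow> complex \<Rightarrow> complex \<Rightarrow> (coord \<Rightarrow> complex) \<Rightarrow> coord \<Rightarrow> complex" where
  "torus_act a b c l m p Cu = l * p Cu"
| "torus_act a b c l m p Cv = l * p Cv"
| "torus_act a b c l m p Cx = m * p Cx"
| "torus_act a b c l m p Cy = m * l powi (- a) * p Cy"
| "torus_act a b c l m p Cz = m * l powi (- b) * p Cz"
| "torus_act a b c l m p Ct = m * l powi (- c) * p Ct"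

definition torus_orbit :: "int \<Rightarrow> int \<Rightarrow> int \<Rightarrow> (coord \<Rightarrow> complex) \<Rightarrow> (coord \<Rightarrow> complex) set" where
  "torus_orbit a b c p = {torus_act a b c l m p | l m. l \<noteq> 0 \<and> m \<noteq> 0}"

text \<open>The points of the scroll are the orbits themselves.\<close>

definition scroll :: "int \<Rightarrow> int \<Rightarrow> int \<Rightarrow> (coord \<Rightarrow> complex) set set" where
  "scroll a b c = torus_orbit a b c `
     {p. (p Cu \<noteq> 0 \<or> p Cv \<noteq> 0) \<and> (p Cx \<noteq> 0 \<or> p Cy \<noteq> 0 \<or> p Cz \<noteq> 0 \<or> p Ct \<noteq> 0)}"

text \<open>Polynomials in the six coordinates are treated as functions, which loses nothing over the
  infinite field \<open>\<complex>\<close>.\<close>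

definition poly_fun :: "((coord \<Rightarrow> complex) \<Rightarrow> complex) \<Rightarrow> bool" where
  "poly_fun f \<longleftrightarrow> (\<exists>S \<alpha>. finite (S :: (coord \<Rightarrow> nat) set) \<and>
     (\<forall>p. f p = (\<Sum>e\<in>S. \<alpha> e * (\<Prod>i\<in>UNIV. p i ^ e i))))"

text \<open>\<open>sections a b c r n\<close> is the space of global sections of \<open>rM + nL\<close>. A regular function on
  \<open>(\<complex>\<^sup>2 - 0) \<times> (\<complex>\<^sup>4 - 0)\<close> extends to a polynomial, because the deleted set has codimension 2.\<close>

definition sections :: "int \<Rightarrow> int \<Rightarrow> int \<Rightarrow> int \<Rightarrow> int \<Rightarrow> ((coord \<Rightarrow> complex) \<Rightarrow> complex) set" where
  "sections a b c r n = {f. poly_fun f \<and>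
     (\<forall>l m p. l \<noteq> 0 \<longrightarrow> m \<noteq> 0 \<longrightarrow> f (torus_act a b c l m p) = l powi n * m powi r * f p)}"

definition zero_locus :: "int \<Rightarrow> int \<Rightarrow> int \<Rightarrow> ((coord \<Rightarrow> complex) \<Rightarrow> complex) \<Rightarrow> (coord \<Rightarrow> complex) set set" where
  "zero_locus a b c f = {P \<in> scroll a b c. \<forall>p\<in>P. f p = 0}"

text \<open>A member of the linear system \<open>|rM + nL|\<close> is given by a nonzero section, up to scalars. If
  there is none, the system is empty and its base locus is the whole scroll.\<close>

definition base_locus :: "int \<Rightarrow> int \<Rightarrow> int \<Rightarrow> int \<Rightarrow> int \<Rightarrow> (coord \<Rightarrow> complex) set set" where
  "base_locus a b c r n = {P \<in> scroll a b c. \<forall>f \<in> sections a b c r n - {\<lambda>_. 0}. P \<in> zero_locus a b c f}"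

definition surface_B :: "int \<Rightarrow> int \<Rightarrow> int \<Rightarrow> (coord \<Rightarrow> complex) set set" where
  "surface_B a b c = zero_locus a b c (\<lambda>p. p Cz) \<inter> zero_locus a b c (\<lambda>p. p Ct)"

definition curve_Gamma :: "int \<Rightarrow> int \<Rightarrow> int \<Rightarrow> (coord \<Rightarrow> complex) set set" where
  "curve_Gamma a b c =
     zero_locus a b c (\<lambda>p. p Cy) \<inter> zero_locus a b c (\<lambda>p. p Cz) \<inter> zero_locus a b c (\<lambda>p. p Ct)"

definition linear_on :: "('a \<Rightarrow> complex) set \<Rightarrow> (('a \<Rightarrow> complex) \<Rightarrow> complex) \<Rightarrow> bool" where
  "linear_on V \<phi> \<longleftrightarrow> (\<forall>f\<in>V. \<forall>g\<in>V. \<forall>r s. \<phi> (\<lambda>p. r * f p + s * g p) = r * \<phi> f + s * \<phi> g)"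

text \<open>\<open>form_on V e G\<close>: on the vector space \<open>V\<close>, \<open>G\<close> is a homogeneous polynomial function of
  degree \<open>e\<close>.\<close>

inductive form_on :: "('a \<Rightarrow> complex) set \<Rightarrow> nat \<Rightarrow> (('a \<Rightarrow> complex) \<Rightarrow> complex) \<Rightarrow> bool"
  for V where
  const: "form_on V 0 (\<lambda>_. r)"
| linear: "linear_on V \<phi> \<Longrightarrow> form_on V 1 \<phi>"
| add: "form_on V e G \<Longrightarrow> form_on V e H \<Longrightarrow> form_on V e (\<lambda>f. G f + H f)"
| mult: "form_on V e G \<Longrightarrow> form_on V e' H \<Longrightarrow> form_on V (e + e') (\<lambda>f. G f * H f)"

text \<open>A general member of \<open>|rM + nL| = \<P>(V)\<close> satisfies \<open>Q\<close> if \<open>Q\<close> holds on a nonempty Zariski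
  open subset; it may be taken of the basic form \<open>G \<noteq> 0\<close> with \<open>G\<close> homogeneous.\<close>

definition general_member ::
  "int \<Rightarrow> int \<Rightarrow> int \<Rightarrow> int \<Rightarrow> int \<Rightarrow> (((coord \<Rightarrow> complex) \<Rightarrow> complex) \<Rightarrow> bool) \<Rightarrow> bool" where
  "general_member a b c r n Q \<longleftrightarrow>
     (\<exists>e G. form_on (sections a b c r n) e G \<and> (\<exists>f \<in> sections a b c r n. G f \<noteq> 0) \<and>
        (\<forall>f \<in> sections a b c r n - {\<lambda>_. 0}. G f \<noteq> 0 \<longrightarrow> Q f))"

text \<open>For irreducible \<open>S\<close>: \<open>Q\<close> holds on a nonempty Zariski open subset of \<open>S\<close>. The sets where
  some bihomogeneous polynomial does not vanish form a basis of the Zariski topology on the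
  scroll.\<close>

definition generically_on ::
  "int \<Rightarrow> int \<Rightarrow> int \<Rightarrow> (coord \<Rightarrow> complex) set set \<Rightarrow> ((coord \<Rightarrow> complex) set \<Rightarrow> bool) \<Rightarrow> bool" where
  "generically_on a b c S Q \<longleftrightarrow>
     (\<exists>r n. \<exists>g \<in> sections a b c r n. \<not> S \<subseteq> zero_locus a b c g \<and>
        (\<forall>P \<in> S - zero_locus a b c g. Q P))"

text \<open>The slice \<open>p w = 1\<close>, \<open>p s = 1\<close> contains exactly one representative of each orbit on which
  the coordinates \<open>w\<close> and \<open>s\<close> do not vanish. It is an affine chart \<open>\<complex>\<^sup>4\<close> of the scroll, in which
  \<open>f\<close> restricts to a local equation of the divisor; the other four coordinates are the chart
  coordinates.\<close>

definition singular_points ::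
  "int \<Rightarrow> int \<Rightarrow> int \<Rightarrow> ((coord \<Rightarrow> complex) \<Rightarrow> complex) \<Rightarrow> (coord \<Rightarrow> complex) set set" where
  "singular_points a b c f = {P \<in> zero_locus a b c f.
     \<forall>w \<in> {Cu, Cv}. \<forall>s \<in> {Cx, Cy, Cz, Ct}. \<forall>p \<in> P. p w = 1 \<and> p s = 1 \<longrightarrow>
       (\<forall>i. i \<notin> {w, s} \<longrightarrow> deriv (\<lambda>\<zeta>. f (p(i := \<zeta>))) (p i) = 0)}"

text \<open>The nonvanishing of \<open>s\<close> on \<open>{t = 0}\<close> is exactly what makes \<open>{s = t = 0}\<close> a surface rather
  than the threefold \<open>{t = 0}\<close>.\<close>

definition contains_surface_st ::
  "int \<Rightarrow> int \<Rightarrow> int \<Rightarrow> ((coord \<Rightarrow> complex) \<Rightarrow> complex) \<Rightarrow> bool" where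
  "contains_surface_st a b c f \<longleftrightarrow>
     (\<exists>s \<in> sections a b c 1 (- b).
        \<not> zero_locus a b c (\<lambda>p. p Ct) \<subseteq> zero_locus a b c s \<and>
        zero_locus a b c s \<inter> zero_locus a b c (\<lambda>p. p Ct) \<subseteq> zero_locus a b c f)"

definition condition1 :: "int \<Rightarrow> int \<Rightarrow> int \<Rightarrow> int \<Rightarrow> bool" where
  "condition1 a b c n \<longleftrightarrow>
     \<not> surface_B a b c \<subseteq> base_locus a b c 3 n \<and>
     (a = b \<longrightarrow> general_member a b c 3 n (\<lambda>f. \<not> contains_surface_st a b c f))"

definition condition2 :: "int \<Rightarrow> int \<Rightarrow> int \<Rightarrow> int \<Rightarrow> bool" where
  "condition2 a b c n \<longleftrightarrow>
     (n < 0 \<longrightarrow> general_member a b c 3 n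
        (\<lambda>f. generically_on a b c (curve_Gamma a b c) (\<lambda>P. P \<notin> singular_points a b c f)))"

end

theory Submission
  imports Defs "HOL-Computational_Algebra.Fundamental_Theorem_Algebra"
begin

text \<open>A section of \<open>3M + nL\<close> is a sum of monomials of the right weight, so for \<open>n < 0\<close> both
  conditions are statements about degrees of coefficients. The surface \<open>B\<close> is not in the base locus
  iff \<open>y\<^sup>3\<close> occurs, that is, \<open>n + 3a \<ge> 0\<close>. If \<open>a = b\<close> and \<open>n + 3a = 0\<close>, then \<open>f\<close> restricted to
  \<open>t = 0\<close> is a binary cubic in \<open>y, z\<close> with constant coefficients, and each of its linear factors is
  a surface \<open>s = t = 0\<close>; if \<open>n + 3a > 0\<close>, a resultant shows that a general \<open>f\<close> has no constant
  factor. A member is generically nonsingular along \<open>\<Gamma>\<close> iff its coefficient of \<open>x\<^sup>2y\<close>, \<open>x\<^sup>2z\<close>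
  or \<open>x\<^sup>2t\<close> is nonzero, which is possible iff \<open>n + c \<ge> 0\<close>. Minimising \<open>a + b + c\<close> under these
  inequalities gives the bounds on \<open>d\<close>.

  For \<open>n \<ge> 0\<close> the scroll with \<open>a = b = 0\<close> works. A general plane cubic contains no line: every
  point of a line in a cubic is a zero of the Hessian, so the restrictions of the cubic and of its
  Hessian to \<open>z = 0\<close> would have a common root, which a resultant excludes.\<close>

section \<open>Weights of monomials\<close>

definition power_prod :: "(coord \<Rightarrow> nat) \<Rightarrow> (coord \<Rightarrow> complex) \<Rightarrow> complex" where
  "power_prod e p = (\<Prod>i\<in>UNIV. p i ^ e i)"

definition twist :: "int \<Rightarrow> int \<Rightarrow> int \<Rightarrow> (coord \<Rightarrow> nat) \<Rightarrow> int" where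
  "twist a b c e = int (e Cu) + int (e Cv) - a * int (e Cy) - b * int (e Cz) - c * int (e Ct)"

definition fibre_degree :: "(coord \<Rightarrow> nat) \<Rightarrow> int" where
  "fibre_degree e = int (e Cx) + int (e Cy) + int (e Cz) + int (e Ct)"

lemma power_prod_expand:
  "power_prod e p = p Cu ^ e Cu * p Cv ^ e Cv * p Cx ^ e Cx * p Cy ^ e Cy * p Cz ^ e Cz * p Ct ^ e Ct"
  by (simp add: power_prod_def UNIV_coord mult.assoc)

lemma power_prod_torus_act:
  assumes "l \<noteq> 0" "m \<noteq> 0"
  shows "power_prod e (torus_act a b c l m p) = l powi twist a b c e * m powi fibre_degree e * power_prod e p"
proof -
  have pw: "(l powi (- q)) ^ k = l powi (- (q * int k))" for q k
    by (metis mult_minus_left power_int_mult power_int_of_nat)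
  have "l powi twist a b c e = l ^ e Cu * l ^ e Cv * (l powi (- a)) ^ e Cy
      * (l powi (- b)) ^ e Cz * (l powi (- c)) ^ e Ct"
  proof -
    have "l powi twist a b c e = l powi (int (e Cu) + int (e Cv) + - (a * int (e Cy))
        + - (b * int (e Cz)) + - (c * int (e Ct)))" by (simp add: twist_def)
    also have "\<dots> = l powi int (e Cu) * l powi int (e Cv) * l powi (- (a * int (e Cy)))
        * l powi (- (b * int (e Cz))) * l powi (- (c * int (e Ct)))"
      using assms by (simp add: power_int_add del: add_uminus_conv_diff)
    finally show ?thesis by (simp only: pw power_int_of_nat)
  qed
  moreover have "m powi fibre_degree e = m ^ e Cx * m ^ e Cy * m ^ e Cz * m ^ e Ct"
    using assms by (simp add: fibre_degree_def power_int_add)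
  ultimately show ?thesis
    by (simp add: power_prod_expand power_mult_distrib)
qed

lemma poly_fun_power_prod: "poly_fun (power_prod e)"
  unfolding poly_fun_def power_prod_def
  by (rule exI[of _ "{e}"], rule exI[of _ "\<lambda>_. 1"]) simp

lemma poly_fun_add:
  assumes "poly_fun f" "poly_fun g"
  shows "poly_fun (\<lambda>p. f p + g p)"
proof -
  from assms(1) obtain S \<alpha> where S: "finite S" "\<And>p. f p = (\<Sum>e\<in>S. \<alpha> e * power_prod e p)"
    unfolding poly_fun_def power_prod_def by blast
  from assms(2) obtain T \<beta> where T: "finite T" "\<And>p. g p = (\<Sum>e\<in>T. \<beta> e * power_prod e p)"
    unfolding poly_fun_def power_prod_def by blast
  have "f p + g p = (\<Sum>e\<in>S \<union> T. ((if e \<in> S then \<alpha> e else 0) + (if e \<in> T then \<beta> e else 0)) * power_prod e p)" for p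
  proof -
    have "f p = (\<Sum>e\<in>S \<union> T. (if e \<in> S then \<alpha> e else 0) * power_prod e p)"
      unfolding S(2) by (rule sum.mono_neutral_cong_left) (use S(1) T(1) in auto)
    moreover have "g p = (\<Sum>e\<in>S \<union> T. (if e \<in> T then \<beta> e else 0) * power_prod e p)"
      unfolding T(2) by (rule sum.mono_neutral_cong_left) (use S(1) T(1) in auto)
    ultimately show ?thesis by (simp add: sum.distrib distrib_right)
  qed
  then show ?thesis
    unfolding poly_fun_def power_prod_def[symmetric] using S(1) T(1)
    by (intro exI[of _ "S \<union> T"]
        exI[of _ "\<lambda>e. (if e \<in> S then \<alpha> e else 0) + (if e \<in> T then \<beta> e else 0)"]) simp
qed

lemma poly_fun_scale:
  assumes "poly_fun f"
  shows "poly_fun (\<lambda>p. k * f p)"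
proof -
  from assms obtain S \<alpha> where S: "finite S" "\<And>p. f p = (\<Sum>e\<in>S. \<alpha> e * power_prod e p)"
    unfolding poly_fun_def power_prod_def by metis
  then have "\<forall>p. k * f p = (\<Sum>e\<in>S. (k * \<alpha> e) * power_prod e p)"
    by (simp add: sum_distrib_left mult.assoc)
  with S(1) show ?thesis unfolding poly_fun_def power_prod_def[symmetric] 
    by (intro exI[of _ S] exI[of _ "\<lambda>e. k * \<alpha> e"]) simp
qed

section \<open>Sections as sums of monomials of a single weight\<close>

lemma sections_add:
  assumes "f \<in> sections a b c r n" "g \<in> sections a b c r n"
  shows "(\<lambda>p. f p + g p) \<in> sections a b c r n"
  using assms by (auto simp: sections_def poly_fun_add distrib_left)

lemma sections_scale:
  assumes "f \<in> sections a b c r n"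
  shows "(\<lambda>p. k * f p) \<in> sections a b c r n"
  using assms by (auto simp: sections_def poly_fun_scale)

lemma power_prod_in_sections:
  assumes "twist a b c e = n" "fibre_degree e = r"
  shows "power_prod e \<in> sections a b c r n"
  using assms by (auto simp: sections_def poly_fun_power_prod power_prod_torus_act)

lemma monomial_in_sections:
  assumes "int h + int h' - a * int j - b * int k - c * int l = n"
    and "int i + int j + int k + int l = r"
  shows "(\<lambda>p. p Cu ^ h * p Cv ^ h' * p Cx ^ i * p Cy ^ j * p Cz ^ k * p Ct ^ l)
    \<in> sections a b c r n"
proof -
  let ?e = "case_coord h h' i j k l"
  have "power_prod ?e \<in> sections a b c r n"
    using assms by (intro power_prod_in_sections) (simp_all add: twist_def fibre_degree_def)
  then show ?thesis by (simp add: power_prod_expand[abs_def])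
qed

lemma zero_in_sections: "(\<lambda>_. 0) \<in> sections a b c r n"
proof -
  have "poly_fun (\<lambda>_. 0)" using poly_fun_scale[OF poly_fun_power_prod, of 0] by simp
  then show ?thesis by (simp add: sections_def)
qed

lemma sections_sum:
  assumes "finite S" "\<And>e. e \<in> S \<Longrightarrow> F e \<in> sections a b c r n"
  shows "(\<lambda>p. \<Sum>e\<in>S. F e p) \<in> sections a b c r n"
  using assms by (induction S rule: finite_induct) (auto simp: zero_in_sections sections_add)

text \<open>Comparison of the coefficients of \<open>l powi n\<close>: two Laurent polynomials that
  agree at all nonzero points have equal coefficients.\<close>

lemma laurent_coefficient:
  fixes c :: "'e \<Rightarrow> complex"
  assumes "finite S" and eq: "\<And>l. l \<noteq> 0 \<Longrightarrow> (\<Sum>e\<in>S. c e * l powi w e) = l powi n * F"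
  shows "F = (\<Sum>e\<in>{e\<in>S. w e = n}. c e)"
proof -
  \<comment> \<open>Multiplication by the power K clears all negative exponents; the sum of all
    absolute values is a crude choice.\<close>
  obtain K where K: "\<And>e. e \<in> S \<Longrightarrow> 0 \<le> w e + K" "0 \<le> n + K"
  proof -
    let ?K = "\<bar>n\<bar> + (\<Sum>e\<in>S. \<bar>w e\<bar>)"
    have "\<bar>w e\<bar> \<le> (\<Sum>e\<in>S. \<bar>w e\<bar>)" if "e \<in> S" for e
      using that assms(1) by (intro member_le_sum) auto
    moreover have "0 \<le> (\<Sum>e\<in>S. \<bar>w e\<bar>)" by (intro sum_nonneg) auto
    ultimately show ?thesis by (intro that[of ?K]) (smt (verit))+
  qed
  define P where "P = (\<Sum>e\<in>S. monom (c e) (nat (w e + K))) - monom F (nat (n + K))"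
  have "poly P l = 0" if "l \<noteq> 0" for l
  proof -
    have pw: "l ^ nat (j + K) = l powi j * l powi K" if "0 \<le> j + K" for j
      using that \<open>l \<noteq> 0\<close> by (metis power_int_add power_int_of_nat nat_0_le)
    have "poly P l = (\<Sum>e\<in>S. c e * (l powi w e * l powi K)) - F * (l powi n * l powi K)"
      using K by (simp add: P_def poly_sum poly_monom pw)
    also have "\<dots> = ((\<Sum>e\<in>S. c e * l powi w e) - l powi n * F) * l powi K"
      by (simp add: sum_distrib_left right_diff_distrib mult_ac)
    finally show ?thesis using eq[OF that] by simp
  qed
  then have "- {0} \<subseteq> {l. poly P l = 0}" by auto
  moreover have "infinite (- {0 :: complex})"
    by (simp add: infinite_UNIV_char_0 finite_compl)
  ultimately have "P = 0"
    using poly_roots_finite finite_subset by blast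
  then have "0 = coeff P (nat (n + K))" by simp
  also have "\<dots> = (\<Sum>e\<in>S. if w e = n then c e else 0) - F"
    using K by (auto simp: P_def coeff_sum nat_eq_iff intro!: sum.cong)
  finally show ?thesis
    using assms(1) by (simp add: sum.inter_filter)
qed

text \<open>Eigenfunctions split by characters: comparing coefficients first in \<open>l\<close> and
  then in \<open>m\<close> discards the monomials of any other weight without changing the
  function.\<close>

lemma sections_expand:
  assumes "f \<in> sections a b c r n"
  obtains S \<alpha> where "finite S" "\<And>e. e \<in> S \<Longrightarrow> twist a b c e = n" "\<And>e. e \<in> S \<Longrightarrow> fibre_degree e = r"
    "f = (\<lambda>p. \<Sum>e\<in>S. \<alpha> e * power_prod e p)"
proof -
  from assms obtain S \<alpha> where S: "finite S" and f: "\<And>p. f p = (\<Sum>e\<in>S. \<alpha> e * power_prod e p)"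
    unfolding sections_def poly_fun_def power_prod_def by blast
  let ?T = "{e\<in>{e\<in>S. twist a b c e = n}. fibre_degree e = r}"
  have "f p = (\<Sum>e\<in>?T. \<alpha> e * power_prod e p)" for p
  proof (rule laurent_coefficient)
    show "finite {e \<in> S. twist a b c e = n}" using S by simp
    fix m :: complex assume m: "m \<noteq> 0"
    have "m powi r * f p =
        (\<Sum>e\<in>{e \<in> S. twist a b c e = n}. \<alpha> e * power_prod e p * m powi fibre_degree e)"
    proof (rule laurent_coefficient[OF S])
      fix l :: complex assume l: "l \<noteq> 0"
      have "(\<Sum>e\<in>S. \<alpha> e * power_prod e p * m powi fibre_degree e * l powi twist a b c e)
          = f (torus_act a b c l m p)"
        unfolding f using l m by (simp add: power_prod_torus_act mult_ac)
      also have "\<dots> = l powi n * (m powi r * f p)"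
        using assms l m by (simp add: sections_def mult.assoc)
      finally show "(\<Sum>e\<in>S. \<alpha> e * power_prod e p * m powi fibre_degree e * l powi twist a b c e)
          = l powi n * (m powi r * f p)" .
    qed
    then show "(\<Sum>e\<in>{e \<in> S. twist a b c e = n}. \<alpha> e * power_prod e p * m powi fibre_degree e)
        = m powi r * f p" by simp
  qed
  with S show ?thesis by (intro that[of ?T \<alpha>]) auto
qed

section \<open>Points and loci of the scroll\<close>

fun pt :: "complex \<Rightarrow> complex \<Rightarrow> complex \<Rightarrow> complex \<Rightarrow> complex \<Rightarrow> complex \<Rightarrow> coord \<Rightarrow> complex" where
  "pt u v x y z t Cu = u"
| "pt u v x y z t Cv = v"
| "pt u v x y z t Cx = x"
| "pt u v x y z t Cy = y"
| "pt u v x y z t Cz = z"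
| "pt u v x y z t Ct = t"

definition semistable :: "(coord \<Rightarrow> complex) \<Rightarrow> bool" where
  "semistable p \<longleftrightarrow> (p Cu \<noteq> 0 \<or> p Cv \<noteq> 0) \<and> (p Cx \<noteq> 0 \<or> p Cy \<noteq> 0 \<or> p Cz \<noteq> 0 \<or> p Ct \<noteq> 0)"

lemma scroll_eq: "scroll a b c = torus_orbit a b c ` {p. semistable p}"
  by (simp add: scroll_def semistable_def)

lemma orbit_self: "p \<in> torus_orbit a b c p"
proof -
  have "p = torus_act a b c 1 1 p"
  proof
    show "p i = torus_act a b c 1 1 p i" for i by (cases i) auto
  qed
  then show ?thesis unfolding torus_orbit_def by force
qed

text \<open>Along an orbit a section changes only by a nonzero factor, so one representative
  decides.\<close>

lemma orbit_in_zero_locus: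
  assumes "f \<in> sections a b c r n" "semistable p"
  shows "torus_orbit a b c p \<in> zero_locus a b c f \<longleftrightarrow> f p = 0"
proof
  show "torus_orbit a b c p \<in> zero_locus a b c f \<Longrightarrow> f p = 0"
    using orbit_self by (auto simp: zero_locus_def)
  show "f p = 0 \<Longrightarrow> torus_orbit a b c p \<in> zero_locus a b c f"
    using assms by (auto simp: zero_locus_def scroll_eq torus_orbit_def sections_def)
qed

lemma coordinate_sections:
  "(\<lambda>p. p Cy) \<in> sections a b c 1 (- a)"
  "(\<lambda>p. p Cz) \<in> sections a b c 1 (- b)"
  "(\<lambda>p. p Ct) \<in> sections a b c 1 (- c)"
  using monomial_in_sections[of 0 0 a 1 b 0 c 0 _ 0] monomial_in_sections[of 0 0 a 0 b 1 c 0 _ 0]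
    monomial_in_sections[of 0 0 a 0 b 0 c 1 _ 0] by simp_all

lemma surface_B_iff:
  assumes "semistable p"
  shows "torus_orbit a b c p \<in> surface_B a b c \<longleftrightarrow> p Cz = 0 \<and> p Ct = 0"
  using assms by (simp add: surface_B_def orbit_in_zero_locus[OF coordinate_sections(2)]
      orbit_in_zero_locus[OF coordinate_sections(3)])

lemma curve_Gamma_iff:
  assumes "semistable p"
  shows "torus_orbit a b c p \<in> curve_Gamma a b c \<longleftrightarrow> p Cy = 0 \<and> p Cz = 0 \<and> p Ct = 0"
  using assms by (simp add: curve_Gamma_def orbit_in_zero_locus[OF coordinate_sections(1)]
      orbit_in_zero_locus[OF coordinate_sections(2)] orbit_in_zero_locus[OF coordinate_sections(3)])

section \<open>General members\<close>

text \<open>Handles the case in which the zero section, which is no member of the system, witnesses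
  \<open>G f \<noteq> 0\<close>: this forces \<open>G\<close> to be a constant.\<close>

lemma form_on_const_or_vanish:
  assumes "form_on V e G" "(\<lambda>_. 0) \<in> V"
  shows "(e = 0 \<longrightarrow> (\<forall>f\<in>V. \<forall>g\<in>V. G f = G g)) \<and> (e > 0 \<longrightarrow> G (\<lambda>_. 0) = 0)"
  using assms
proof (induction rule: form_on.induct)
  case (linear \<phi>)
  from linear(1)[unfolded linear_on_def, rule_format, OF linear(2) linear(2), of 0 0]
  show ?case by simp
next
  case (add e G H)
  then show ?case by (metis add.right_neutral)
next
  case (mult e G e' H)
  then show ?case by (metis add_is_0 gr0I mult_zero_left mult_zero_right)
qed auto

text \<open>For an empty linear system \<open>general_member\<close> can hold vacuously; the nonzero
  section \<open>h\<close> rules this out. It also serves as the member itself when \<open>G\<close>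
  is constant.\<close>

lemma general_member_witness:
  assumes "general_member a b c r n Q" "h \<in> sections a b c r n" "h \<noteq> (\<lambda>_. 0)"
  obtains f where "f \<in> sections a b c r n" "f \<noteq> (\<lambda>_. 0)" "Q f"
proof -
  from assms(1) obtain e G f where G: "form_on (sections a b c r n) e G"
    and f: "f \<in> sections a b c r n" "G f \<noteq> 0"
    and Q: "\<And>f. f \<in> sections a b c r n - {\<lambda>_. 0} \<Longrightarrow> G f \<noteq> 0 \<Longrightarrow> Q f"
    unfolding general_member_def by blast
  show ?thesis
  proof (cases "f = (\<lambda>_. 0)")
    case True
    then have "G h = G f"
      using form_on_const_or_vanish[OF G zero_in_sections] assms(2) f by (metis gr0I)
    with f Q[of h] assms show ?thesis by (intro that[of h]) auto
  next
    case False
    with f Q show ?thesis by (intro that[of f]) auto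
  qed
qed

lemma form_on_eval: "form_on V 1 (\<lambda>f. f p)"
  by (rule form_on.linear) (simp add: linear_on_def)

lemma form_on_scale: "form_on V e G \<Longrightarrow> form_on V e (\<lambda>f. k * G f)"
  using form_on.mult[OF form_on.const[of V k], of e G] by simp

lemma form_on_diff:
  assumes "form_on V e G" "form_on V e H"
  shows "form_on V e (\<lambda>f. G f - H f)"
  using form_on.add[OF assms(1) form_on_scale[OF assms(2), of "- 1"]] by simp

lemma form_on_mult3:
  "form_on V e G \<Longrightarrow> form_on V e H \<Longrightarrow> form_on V e K \<Longrightarrow> form_on V (e + e + e) (\<lambda>f. G f * H f * K f)"
  by (intro form_on.mult)

section \<open>The resultant of two binary cubics\<close>

definition binary_cubic :: "(complex \<Rightarrow> complex \<Rightarrow> complex) \<Rightarrow> bool" where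
  "binary_cubic h \<longleftrightarrow> (\<exists>k0 k1 k2 k3. \<forall>x y.
     h x y = k0 * x ^ 3 + k1 * x ^ 2 * y + k2 * x * y ^ 2 + k3 * y ^ 3)"

text \<open>The coefficients are read off from values of the cubic, so that they are visibly linear
  in it.\<close>

fun cubic_coeff :: "nat \<Rightarrow> (complex \<Rightarrow> complex \<Rightarrow> complex) \<Rightarrow> complex" where
  "cubic_coeff 0 h = h 1 0"
| "cubic_coeff (Suc 0) h = (1/2) * (h 1 1 - h 1 (-1)) - h 0 1"
| "cubic_coeff (Suc (Suc 0)) h = (1/2) * (h 1 1 + h 1 (-1)) - h 1 0"
| "cubic_coeff (Suc (Suc (Suc _))) h = h 0 1"

lemma binary_cubic_expand:
  assumes "binary_cubic h"
  shows "h x y = cubic_coeff 0 h * x ^ 3 + cubic_coeff 1 h * x ^ 2 * y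
    + cubic_coeff 2 h * x * y ^ 2 + cubic_coeff 3 h * y ^ 3"
  using assms by (auto simp: binary_cubic_def numeral_2_eq_2 numeral_3_eq_3 field_simps)

definition bracket where
  "bracket h g i j = cubic_coeff i h * cubic_coeff j g - cubic_coeff j h * cubic_coeff i g"

text \<open>The determinant of the symmetric matrix with rows (a, b, c), (b, d, e), (c, e,
  f).\<close>

definition det3 :: "complex \<Rightarrow> complex \<Rightarrow> complex \<Rightarrow> complex \<Rightarrow> complex \<Rightarrow> complex \<Rightarrow> complex" where
  "det3 a b c d e f = a * d * f - a * e * e - b * b * f + b * c * e + c * b * e - c * c * d"

text \<open>The determinant of the Bezout matrix, which is symmetric of size 3, in place of the
  Sylvester determinant of size 6.\<close>

definition cubic_resultant where
  "cubic_resultant h g = det3 (bracket h g 0 1) (bracket h g 0 2) (bracket h g 0 3)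
     (bracket h g 0 3 + bracket h g 1 2) (bracket h g 1 3) (bracket h g 2 3)"

lemma form_on_cubic_coeff:
  assumes "\<And>x y. form_on V e (\<lambda>f. h f x y)"
  shows "form_on V e (\<lambda>f. cubic_coeff i (h f))"
proof -
  consider "i = 0" | "i = Suc 0" | "i = Suc (Suc 0)" | j where "i = Suc (Suc (Suc j))"
    by (metis not0_implies_Suc)
  then show ?thesis
    by cases (simp_all only: cubic_coeff.simps,
        (intro form_on_diff form_on_scale form_on.add assms)+)
qed

lemma form_on_det3:
  assumes "form_on V e A" "form_on V e B" "form_on V e C" "form_on V e D" "form_on V e E" "form_on V e F"
  shows "form_on V (e + e + e) (\<lambda>f. det3 (A f) (B f) (C f) (D f) (E f) (F f))"
  unfolding det3_def by (intro form_on_diff form_on.add form_on_mult3 assms)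

text \<open>Different degrees are allowed because the entries of a cubic and of its Hessian have
  degrees 1 and 3 in the section. The resulting degree is left open, as
  \<open>general_member\<close> asks only for some degree.\<close>

lemma form_on_cubic_resultant:
  assumes h: "\<And>x y. form_on V e (\<lambda>f. h f x y)" and g: "\<And>x y. form_on V e' (\<lambda>f. g f x y)"
  obtains d where "form_on V d (\<lambda>f. cubic_resultant (h f) (g f))"
proof -
  have "form_on V (e + e') (\<lambda>f. bracket (h f) (g f) i j)" for i j
    unfolding bracket_def
    by (intro form_on_diff form_on.mult form_on_cubic_coeff h g)
  then have "form_on V ((e + e') + (e + e') + (e + e')) (\<lambda>f. cubic_resultant (h f) (g f))"
    unfolding cubic_resultant_def by (intro form_on_det3 form_on.add)
  then show ?thesis by (rule that)
qed

text \<open>Cramer's rule: the adjugate matrix shows that the determinant kills each entry of a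
  kernel vector.\<close>

lemma det3_eq_0:
  assumes "a * p + b * q + c * r = 0" "b * p + d * q + e * r = 0" "c * p + e * q + f * r = 0"
    and "p \<noteq> 0 \<or> q \<noteq> 0 \<or> r \<noteq> 0"
  shows "det3 a b c d e f = 0"
proof -
  have "p * det3 a b c d e f = 0" "q * det3 a b c d e f = 0" "r * det3 a b c d e f = 0"
    unfolding det3_def using assms(1-3) by algebra+
  with assms(4) show ?thesis by auto
qed

text \<open>At a common root (p, q) the vector (p^2, pq, q^2) lies in the kernel of the Bezout
  matrix.\<close>

lemma cubic_resultant_eq_0:
  assumes "binary_cubic h" "binary_cubic g" "h p q = 0" "g p q = 0" "p \<noteq> 0 \<or> q \<noteq> 0"
  shows "cubic_resultant h g = 0"
proof -
  define a0 a1 a2 a3 where "a0 = cubic_coeff 0 h" "a1 = cubic_coeff 1 h"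
    "a2 = cubic_coeff 2 h" "a3 = cubic_coeff 3 h"
  define b0 b1 b2 b3 where "b0 = cubic_coeff 0 g" "b1 = cubic_coeff 1 g"
    "b2 = cubic_coeff 2 g" "b3 = cubic_coeff 3 g"
  note defs = a0_a1_a2_a3_def b0_b1_b2_b3_def
  define A where "A = a0 * p ^ 3 + a1 * p ^ 2 * q + a2 * p * q ^ 2 + a3 * q ^ 3"
  define B where "B = b0 * p ^ 3 + b1 * p ^ 2 * q + b2 * p * q ^ 2 + b3 * q ^ 3"
  have "A = 0"
    unfolding A_def defs using binary_cubic_expand[OF assms(1), of p q, symmetric] assms(3) by (rule trans)
  have "B = 0"
    unfolding B_def defs using binary_cubic_expand[OF assms(2), of p q, symmetric] assms(4) by (rule trans)
  \<comment> \<open>\<open>R1\<close>, \<open>R2\<close>, \<open>R3\<close> are the rows of the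
    Bezout matrix applied to this vector.\<close>
  define R1 where "R1 = (a0*b1-a1*b0) * p^2 + (a0*b2-a2*b0) * (p*q) + (a0*b3-a3*b0) * q^2"
  define R2 where "R2 = (a0*b2-a2*b0) * p^2 + ((a0*b3-a3*b0)+(a1*b2-a2*b1)) * (p*q) + (a1*b3-a3*b1) * q^2"
  define R3 where "R3 = (a0*b3-a3*b0) * p^2 + (a1*b3-a3*b1) * (p*q) + (a2*b3-a3*b2) * q^2"
  \<comment> \<open>Each row, multiplied by a power of q or by a power of p, is a combination of
    \<open>A\<close> and \<open>B\<close>. Both versions are proved because only one of p and q is
    known to be nonzero.\<close>
  have "q * R1 = a0 * B - b0 * A"
    unfolding A_def B_def R1_def by (simp add: algebra_simps power2_eq_square power3_eq_cube)
  moreover have "p^3 * R1 = A * (b1 * p^2 + b2 * p * q + b3 * q^2) - B * (a1 * p^2 + a2 * p * q + a3 * q^2)"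
    unfolding A_def B_def R1_def by (simp add: algebra_simps power2_eq_square power3_eq_cube)
  moreover have "q^2 * R2 = (a0 * p + a1 * q) * B - (b0 * p + b1 * q) * A"
    unfolding A_def B_def R2_def by (simp add: algebra_simps power2_eq_square power3_eq_cube)
  moreover have "p^2 * R2 = (b2 * p + b3 * q) * A - (a2 * p + a3 * q) * B"
    unfolding A_def B_def R2_def by (simp add: algebra_simps power2_eq_square power3_eq_cube)
  moreover have "q^3 * R3 = (a0 * p^2 + a1 * p * q + a2 * q^2) * B - (b0 * p^2 + b1 * p * q + b2 * q^2) * A"
    unfolding A_def B_def R3_def by (simp add: algebra_simps power2_eq_square power3_eq_cube)
  moreover have "p * R3 = b3 * A - a3 * B"
    unfolding A_def B_def R3_def by (simp add: algebra_simps power2_eq_square power3_eq_cube)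
  ultimately have "R1 = 0" "R2 = 0" "R3 = 0"
    using assms(5) \<open>A = 0\<close> \<open>B = 0\<close> by auto
  then have "det3 (a0*b1-a1*b0) (a0*b2-a2*b0) (a0*b3-a3*b0) ((a0*b3-a3*b0)+(a1*b2-a2*b1))
      (a1*b3-a3*b1) (a2*b3-a3*b2) = 0"
    using assms(5) unfolding R1_def R2_def R3_def
    by (intro det3_eq_0[where p = "p^2" and q = "p*q" and r = "q^2"]) auto
  then show ?thesis
    by (simp add: cubic_resultant_def bracket_def defs)
qed

section \<open>Plane cubics containing a line\<close>

text \<open>One function on exponent triples holds all ten coefficients, so a sum or a monomial
  needs a single witness.\<close>

definition ternary_cubic :: "(complex \<Rightarrow> complex \<Rightarrow> complex \<Rightarrow> complex) \<Rightarrow> bool" where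
  "ternary_cubic C \<longleftrightarrow> (\<exists>k :: nat \<times> nat \<times> nat \<Rightarrow> complex. \<forall>x y z. C x y z =
     k (3,0,0) * x ^ 3 + k (0,3,0) * y ^ 3 + k (0,0,3) * z ^ 3 + k (2,1,0) * x ^ 2 * y
     + k (2,0,1) * x ^ 2 * z + k (1,2,0) * x * y ^ 2 + k (0,2,1) * y ^ 2 * z
     + k (1,0,2) * x * z ^ 2 + k (0,1,2) * y * z ^ 2 + k (1,1,1) * x * y * z)"

lemma ternary_cubic_zero: "ternary_cubic (\<lambda>_ _ _. 0)"
  unfolding ternary_cubic_def by (rule exI[of _ "\<lambda>_. 0"]) simp

lemma ternary_cubic_add:
  assumes "ternary_cubic C" "ternary_cubic D"
  shows "ternary_cubic (\<lambda>x y z. C x y z + D x y z)"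
proof -
  from assms(1) obtain k :: "nat \<times> nat \<times> nat \<Rightarrow> complex" where k: "\<And>x y z. C x y z =
     k (3,0,0) * x ^ 3 + k (0,3,0) * y ^ 3 + k (0,0,3) * z ^ 3 + k (2,1,0) * x ^ 2 * y
     + k (2,0,1) * x ^ 2 * z + k (1,2,0) * x * y ^ 2 + k (0,2,1) * y ^ 2 * z
     + k (1,0,2) * x * z ^ 2 + k (0,1,2) * y * z ^ 2 + k (1,1,1) * x * y * z"
    unfolding ternary_cubic_def by blast
  from assms(2) obtain l :: "nat \<times> nat \<times> nat \<Rightarrow> complex" where l: "\<And>x y z. D x y z =
     l (3,0,0) * x ^ 3 + l (0,3,0) * y ^ 3 + l (0,0,3) * z ^ 3 + l (2,1,0) * x ^ 2 * y
     + l (2,0,1) * x ^ 2 * z + l (1,2,0) * x * y ^ 2 + l (0,2,1) * y ^ 2 * z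
     + l (1,0,2) * x * z ^ 2 + l (0,1,2) * y * z ^ 2 + l (1,1,1) * x * y * z"
    unfolding ternary_cubic_def by blast
  show ?thesis
    unfolding ternary_cubic_def k l
    by (rule exI[of _ "\<lambda>t. k t + l t"]) (simp add: distrib_right)
qed

lemma ternary_cubic_monomial:
  assumes "i + j + k = 3"
  shows "ternary_cubic (\<lambda>x y z. r * (x ^ i * y ^ j * z ^ k))"
proof -
  have "(i, j, k) \<in> {(3,0,0), (0,3,0), (0,0,3), (2,1,0), (2,0,1), (1,2,0), (0,2,1), (1,0,2),
      (0,1,2), (1,1,1)}"
    using assms by simp presburger
  then show ?thesis
    unfolding ternary_cubic_def
    by (intro exI[of _ "\<lambda>t. if t = (i, j, k) then r else 0"]) (elim insertE emptyE; simp)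
qed

text \<open>With u and v fixed, their powers are absorbed into the coefficients, and t = 0 kills the
  monomials containing t.\<close>

lemma section_ternary_cubic:
  assumes "f \<in> sections a b c 3 n"
  shows "ternary_cubic (\<lambda>x y z. f (pt u v x y z 0))"
proof -
  from assms obtain S \<alpha> where S: "finite S" "\<And>e. e \<in> S \<Longrightarrow> fibre_degree e = 3"
    and f: "f = (\<lambda>p. \<Sum>e\<in>S. \<alpha> e * power_prod e p)"
    by (rule sections_expand) blast
  have summand: "ternary_cubic (\<lambda>x y z. \<alpha> e * power_prod e (pt u v x y z 0))" if "e \<in> S" for e
  proof (cases "e Ct = 0")
    case True
    with S(2)[OF that] have "e Cx + e Cy + e Cz = 3" by (simp add: fibre_degree_def)
    from ternary_cubic_monomial[OF this, of "\<alpha> e * u ^ e Cu * v ^ e Cv"] True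
    show ?thesis by (simp add: power_prod_expand mult_ac)
  qed (simp add: power_prod_expand power_0_left ternary_cubic_zero)
  show ?thesis
    unfolding f using S(1) summand
    by (induction S rule: finite_induct) (auto simp: ternary_cubic_zero intro: ternary_cubic_add)
qed

lemma ternary_cubic_at_0: "ternary_cubic C \<Longrightarrow> C 0 0 0 = 0"
  by (auto simp: ternary_cubic_def)

lemma ternary_cubic_restrict_x: "ternary_cubic C \<Longrightarrow> binary_cubic (\<lambda>y z. C 0 y z)"
  unfolding ternary_cubic_def binary_cubic_def
  apply (elim exE)
  subgoal for k
    by (rule exI[of _ "k (0,3,0)"], rule exI[of _ "k (0,2,1)"], rule exI[of _ "k (0,1,2)"],
        rule exI[of _ "k (0,0,3)"]) simp
  done

lemma ternary_cubic_restrict_z: "ternary_cubic C \<Longrightarrow> binary_cubic (\<lambda>x y. C x y 0)"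
  unfolding ternary_cubic_def binary_cubic_def
  apply (elim exE)
  subgoal for k
    by (rule exI[of _ "k (3,0,0)"], rule exI[of _ "k (2,1,0)"], rule exI[of _ "k (1,2,0)"],
        rule exI[of _ "k (0,3,0)"]) simp
  done

text \<open>For a cubic \<open>C\<close> the mixed second difference is exactly the Hessian bilinear form at
  \<open>(x, y, 0)\<close>, so the entries of the Hessian matrix are linear in the values of \<open>C\<close>.\<close>

definition polar where
  "polar C x y d1 d2 d3 e1 e2 e3 = (1/4) *
     ((C (x + d1 + e1) (y + d2 + e2) (d3 + e3) - C (x + d1 - e1) (y + d2 - e2) (d3 - e3))
     - (C (x - d1 + e1) (y - d2 + e2) (e3 - d3) - C (x - d1 - e1) (y - d2 - e2) (- d3 - e3)))"

definition hessian :: "(complex \<Rightarrow> complex \<Rightarrow> complex \<Rightarrow> complex) \<Rightarrow> complex \<Rightarrow> complex \<Rightarrow> complex" where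
  "hessian C x y = det3 (polar C x y 1 0 0 1 0 0) (polar C x y 1 0 0 0 1 0) (polar C x y 1 0 0 0 0 1)
     (polar C x y 0 1 0 0 1 0) (polar C x y 0 1 0 0 0 1) (polar C x y 0 0 1 0 0 1)"

text \<open>The alternating sum keeps only the terms odd in both directions. In a cubic these have
  degree one in each direction, and hence degree one in the base point as well.\<close>

lemma polar_bilinear:
  assumes "ternary_cubic C"
  shows "polar C x y d1 d2 d3 e1 e2 e3 =
      polar C x y 1 0 0 1 0 0 * d1 * e1 + polar C x y 0 1 0 0 1 0 * d2 * e2
    + polar C x y 0 0 1 0 0 1 * d3 * e3 + polar C x y 1 0 0 0 1 0 * (d1 * e2 + d2 * e1)
    + polar C x y 1 0 0 0 0 1 * (d1 * e3 + d3 * e1) + polar C x y 0 1 0 0 0 1 * (d2 * e3 + d3 * e2)"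
  using assms unfolding ternary_cubic_def polar_def
  by (elim exE) (simp add: algebra_simps power2_eq_square power3_eq_cube)

text \<open>Linearity in the base point makes every triple product in the Hessian determinant a
  binary cubic.\<close>

lemma polar_linear:
  assumes C: "ternary_cubic C"
  shows "polar C x y d1 d2 d3 e1 e2 e3 =
    polar C 1 0 d1 d2 d3 e1 e2 e3 * x + polar C 0 1 d1 d2 d3 e1 e2 e3 * y"
proof -
  have "polar C x y 1 0 0 1 0 0 = polar C 1 0 1 0 0 1 0 0 * x + polar C 0 1 1 0 0 1 0 0 * y"
    "polar C x y 1 0 0 0 1 0 = polar C 1 0 1 0 0 0 1 0 * x + polar C 0 1 1 0 0 0 1 0 * y"
    "polar C x y 1 0 0 0 0 1 = polar C 1 0 1 0 0 0 0 1 * x + polar C 0 1 1 0 0 0 0 1 * y"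
    "polar C x y 0 1 0 0 1 0 = polar C 1 0 0 1 0 0 1 0 * x + polar C 0 1 0 1 0 0 1 0 * y"
    "polar C x y 0 1 0 0 0 1 = polar C 1 0 0 1 0 0 0 1 * x + polar C 0 1 0 1 0 0 0 1 * y"
    "polar C x y 0 0 1 0 0 1 = polar C 1 0 0 0 1 0 0 1 * x + polar C 0 1 0 0 1 0 0 1 * y"
    using C unfolding ternary_cubic_def polar_def
    by (elim exE; simp add: algebra_simps power2_eq_square power3_eq_cube)+
  then show ?thesis
    unfolding polar_bilinear[OF C, of _ _ d1 d2 d3 e1 e2 e3] by (simp add: algebra_simps)
qed

lemma binary_cubic_add:
  "binary_cubic h \<Longrightarrow> binary_cubic g \<Longrightarrow> binary_cubic (\<lambda>x y. h x y + g x y)"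
  unfolding binary_cubic_def
  apply (elim exE)
  subgoal for k0 l0 k1 l1 k2 l2 k3 l3
    by (rule exI[of _ "k0 + l0"], rule exI[of _ "k1 + l1"], rule exI[of _ "k2 + l2"],
        rule exI[of _ "k3 + l3"]) (simp add: distrib_right)
  done

lemma binary_cubic_diff:
  "binary_cubic h \<Longrightarrow> binary_cubic g \<Longrightarrow> binary_cubic (\<lambda>x y. h x y - g x y)"
  unfolding binary_cubic_def
  apply (elim exE)
  subgoal for k0 l0 k1 l1 k2 l2 k3 l3
    by (rule exI[of _ "k0 - l0"], rule exI[of _ "k1 - l1"], rule exI[of _ "k2 - l2"],
        rule exI[of _ "k3 - l3"]) (simp add: left_diff_distrib)
  done

lemma binary_cubic_prod:
  "binary_cubic (\<lambda>x y. (a * x + a' * y) * (b * x + b' * y) * (c * x + c' * y))"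
  unfolding binary_cubic_def
  by (rule exI[of _ "a * b * c"], rule exI[of _ "a * b * c' + a * b' * c + a' * b * c"],
      rule exI[of _ "a * b' * c' + a' * b * c' + a' * b' * c"], rule exI[of _ "a' * b' * c'"])
    (simp add: algebra_simps power2_eq_square power3_eq_cube)

lemma binary_cubic_hessian:
  assumes "ternary_cubic C"
  shows "binary_cubic (hessian C)"
proof -
  have "binary_cubic (\<lambda>x y. hessian C x y)"
    unfolding hessian_def det3_def
    \<comment> \<open>The eighteen occurrences are the three factors of each of the six products in
      \<open>det3\<close>.\<close>
    by (subst (1 2 3 4 5 6 7 8 9 10 11 12 13 14 15 16 17 18) polar_linear[OF assms])
      (intro binary_cubic_add binary_cubic_diff binary_cubic_prod)
  then show ?thesis by simp
qed

text \<open>The Hessian form is isotropic on the plane over a line of the cubic, hence degenerate.\<close>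

lemma hessian_eq_0_on_line:
  assumes C: "ternary_cubic C" and pq: "p \<noteq> 0 \<or> q \<noteq> 0"
    and line: "\<And>s t. C (s * p + t * d) (s * q + t * e) t = 0"
  shows "hessian C p q = 0"
proof -
  have line': "C x y t = 0" if "x = s * p + t * d" "y = s * q + t * e" for x y s t
    using line that by simp
  define A B E F K L where "A = polar C p q 1 0 0 1 0 0" "B = polar C p q 1 0 0 0 1 0"
    "E = polar C p q 1 0 0 0 0 1" "F = polar C p q 0 1 0 0 1 0" "K = polar C p q 0 1 0 0 0 1"
    "L = polar C p q 0 0 1 0 0 1"
  note defs = A_B_E_F_K_L_def
  have bil: "polar C p q d1 d2 d3 e1 e2 e3 = A * d1 * e1 + F * d2 * e2 + L * d3 * e3
      + B * (d1 * e2 + d2 * e1) + E * (d1 * e3 + d3 * e1) + K * (d2 * e3 + d3 * e2)"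
    for d1 d2 d3 e1 e2 e3
    unfolding defs by (rule polar_bilinear[OF C])
  \<comment> \<open>The line is spanned by (p, q, 0) and (d, e, 1). In all three pairings of these
    vectors the four points of the second difference stay in their span, where \<open>C\<close>
    vanishes.\<close>
  have "polar C p q p q 0 p q 0 = 0"
    unfolding polar_def
    by (simp add: line'[where s = 3] line'[where s = 1] line'[where s = "- 1"])
  then have 1: "A * p^2 + 2 * B * p * q + F * q^2 = 0"
    unfolding bil by (simp add: algebra_simps power2_eq_square)
  have "polar C p q p q 0 d e 1 = 0"
    unfolding polar_def
    by (simp add: line'[where s = 2] line'[where s = 0])
  then have 2: "p * (A * d + B * e + E) + q * (B * d + F * e + K) = 0"
    unfolding bil by (simp add: algebra_simps)
  have "polar C p q d e 1 d e 1 = 0"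
    unfolding polar_def
    by (simp add: line'[where s = 1])
  then have 3: "A * d^2 + 2 * B * d * e + F * e^2 + 2 * E * d + 2 * K * e + L = 0"
    unfolding bil by (simp add: algebra_simps power2_eq_square)
  \<comment> \<open>Replacing the third basis vector by (d, e, 1) is a unimodular change of basis.
    \<open>E'\<close> and \<open>K'\<close> are the new off-diagonal entries, the new last diagonal
    entry is 0 by fact 3, and fact 4 expands the same determinant in this basis.\<close>
  define E' K' where "E' = A * d + B * e + E" "K' = B * d + F * e + K"
  have 4: "det3 A B E F K L = 2 * B * E' * K' - A * K'^2 - F * E'^2
      + (A * F - B^2) * (A * d^2 + 2 * B * d * e + F * e^2 + 2 * E * d + 2 * K * e + L)"
    unfolding det3_def E'_K'_def by (simp add: algebra_simps power2_eq_square)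
  have 5: "p * E' = - (q * K')" using 2 unfolding E'_K'_def by (simp add: add_eq_0_iff)
  \<comment> \<open>By fact 5 the vector (E', K') is proportional to (q, -p); substitution turns the
    determinant into a multiple of the isotropy relation 1.\<close>
  have "p^2 * det3 A B E F K L = 2 * B * p * (p * E') * K' - A * p^2 * K'^2 - F * (p * E')^2"
    unfolding 4 3 by (simp add: algebra_simps power2_eq_square)
  also have "\<dots> = - (A * p^2 + 2 * B * p * q + F * q^2) * K'^2"
    unfolding 5 by (simp add: algebra_simps power2_eq_square)
  finally have 6: "p^2 * det3 A B E F K L = 0" using 1 by simp
  have "q^2 * det3 A B E F K L = 2 * B * q * E' * (q * K') - A * (q * K')^2 - F * q^2 * E'^2"
    unfolding 4 3 by (simp add: algebra_simps power2_eq_square)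
  also have "q * K' = - (p * E')" using 5 by simp
  also have "2 * B * q * E' * (- (p * E')) - A * (- (p * E'))^2 - F * q^2 * E'^2
      = - (A * p^2 + 2 * B * p * q + F * q^2) * E'^2"
    by (simp add: algebra_simps power2_eq_square)
  finally have 7: "q^2 * det3 A B E F K L = 0" using 1 by simp
  from 6 7 pq show ?thesis unfolding hessian_def defs by auto
qed

lemma cubic_resultant_zero_left: "cubic_resultant (\<lambda>_ _. 0) g = 0"
proof -
  have "cubic_coeff i (\<lambda>_ _. 0) = 0" for i
    by (cases "(i, \<lambda>(_ :: complex) (_ :: complex). 0 :: complex)" rule: cubic_coeff.cases) auto
  then show ?thesis by (simp add: cubic_resultant_def bracket_def det3_def)
qed

text \<open>The line meets z = 0 in (s, -r, 0), a common root of the cubic and its Hessian. If r = s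
  = 0, the line is z = 0 itself and the restricted cubic is zero.\<close>

lemma resultant_hessian_eq_0:
  assumes C: "ternary_cubic C" and nz: "r \<noteq> 0 \<or> s \<noteq> 0 \<or> t \<noteq> 0"
    and line: "\<And>x y z. r * x + s * y + t * z = 0 \<Longrightarrow> C x y z = 0"
  shows "cubic_resultant (\<lambda>x y. C x y 0) (hessian C) = 0"
proof (cases "r = 0 \<and> s = 0")
  case True
  then have "C x y 0 = 0" for x y using line by simp
  then show ?thesis by (simp add: cubic_resultant_zero_left)
next
  case False
  \<comment> \<open>A second point (d, e, 1) of the line, off z = 0.\<close>
  have "\<exists>d e. r * d + s * e + t = 0"
  proof (cases "r = 0")
    case True
    with False show ?thesis by (intro exI[of _ 0] exI[of _ "- t / s"]) simp
  next
    case False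
    then show ?thesis by (intro exI[of _ "- t / r"] exI[of _ 0]) simp
  qed
  then obtain d e where de: "r * d + s * e + t = 0" by blast
  have "C (x * s + z * d) (x * (- r) + z * e) z = 0" for x z
  proof (rule line)
    have "r * (x * s + z * d) + s * (x * (- r) + z * e) + t * z = z * (r * d + s * e + t)"
      by (simp add: algebra_simps)
    then show "r * (x * s + z * d) + s * (x * (- r) + z * e) + t * z = 0"
      by (simp add: de)
  qed
  with False C have "hessian C s (- r) = 0"
    by (intro hessian_eq_0_on_line[where d = d and e = e]) auto
  moreover have "C s (- r) 0 = 0" by (rule line) simp
  ultimately show ?thesis
    using False C
    by (intro cubic_resultant_eq_0[where p = s and q = "- r"])
      (auto intro: ternary_cubic_restrict_z binary_cubic_hessian)
qed

section \<open>Surfaces contained in members\<close>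

text \<open>A monomial of this weight without t is y or z with constant coefficient; x would need
  degree -a in u and v, which leaves only a = 0.\<close>

lemma section_M_minus_aL:
  assumes "s \<in> sections a a c 1 (- a)" "0 \<le> a"
  shows "\<exists>\<xi> \<eta> \<zeta>. (0 < a \<longrightarrow> \<xi> = 0) \<and> (\<forall>p. p Ct = 0 \<longrightarrow> s p = \<xi> * p Cx + \<eta> * p Cy + \<zeta> * p Cz)"
proof -
  define Q where "Q g \<longleftrightarrow> (\<exists>\<xi> \<eta> \<zeta>. (0 < a \<longrightarrow> \<xi> = 0) \<and>
    (\<forall>p. p Ct = 0 \<longrightarrow> g p = \<xi> * p Cx + \<eta> * p Cy + \<zeta> * p Cz))" for g :: "(coord \<Rightarrow> complex) \<Rightarrow> complex"
  from assms(1) obtain S \<alpha> where S: "finite S" "\<And>e. e \<in> S \<Longrightarrow> fibre_degree e = 1"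
      "\<And>e. e \<in> S \<Longrightarrow> twist a a c e = - a"
    and s: "s = (\<lambda>p. \<Sum>e\<in>S. \<alpha> e * power_prod e p)"
    by (rule sections_expand) blast
  have Q_zero: "Q (\<lambda>_. 0)"
    unfolding Q_def by (intro exI[of _ 0]) simp
  have Q_add: "Q (\<lambda>p. g p + h p)" if "Q g" "Q h" for g h
  proof -
    from that(1) obtain x y z where g: "0 < a \<longrightarrow> x = 0" "\<And>p. p Ct = 0 \<Longrightarrow> g p = x * p Cx + y * p Cy + z * p Cz"
      unfolding Q_def by blast
    from that(2) obtain x' y' z' where h: "0 < a \<longrightarrow> x' = 0" "\<And>p. p Ct = 0 \<Longrightarrow> h p = x' * p Cx + y' * p Cy + z' * p Cz"
      unfolding Q_def by blast
    show ?thesis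
      unfolding Q_def using g h
      by (intro exI[of _ "x + x'"] exI[of _ "y + y'"] exI[of _ "z + z'"]) (simp add: distrib_right)
  qed
  have summand: "Q (\<lambda>p. \<alpha> e * power_prod e p)" if "e \<in> S" for e
  proof -
    have deg: "int (e Cx) + int (e Cy) + int (e Cz) + int (e Ct) = 1"
      using S(2)[OF that] by (simp add: fibre_degree_def)
    have tw: "int (e Cu) + int (e Cv) - a * int (e Cy) - a * int (e Cz) - c * int (e Ct) = - a"
      using S(3)[OF that] by (simp add: twist_def)
    from deg consider "e Ct = 1" | "e Cx = 1" "e Cy = 0" "e Cz = 0" "e Ct = 0"
      | "e Cx = 0" "e Cy = 1" "e Cz = 0" "e Ct = 0" | "e Cx = 0" "e Cy = 0" "e Cz = 1" "e Ct = 0"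
      by linarith
    then show ?thesis
    proof cases
      case 1
      then have "power_prod e p = 0" if "p Ct = 0" for p
        using that by (simp add: power_prod_expand)
      then show ?thesis unfolding Q_def by (intro exI[of _ 0]) simp
    next
      case 2
      with tw assms(2) have "a = 0" "e Cu = 0" "e Cv = 0" by auto
      with 2 show ?thesis
        unfolding Q_def by (intro exI[of _ "\<alpha> e"] exI[of _ 0]) (simp add: power_prod_expand)
    next
      case 3
      with tw have "e Cu = 0" "e Cv = 0" by auto
      with 3 show ?thesis
        unfolding Q_def by (intro exI[of _ 0] exI[of _ "\<alpha> e"] conjI exI[of _ "0 :: complex"])
          (simp_all add: power_prod_expand)
    next
      case 4
      with tw have "e Cu = 0" "e Cv = 0" by auto
      with 4 show ?thesis
        unfolding Q_def by (intro exI[of _ 0] exI[of _ "\<alpha> e"]) (simp add: power_prod_expand)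
    qed
  qed
  have "Q s"
    unfolding s using S(1) summand
    by (induction S rule: finite_induct) (auto simp: Q_zero intro: Q_add)
  then show ?thesis by (simp add: Q_def)
qed

lemma contains_surface_st_plane:
  assumes "contains_surface_st a a c f" "f \<in> sections a a c 3 n" "0 \<le> a"
  obtains \<xi> \<eta> \<zeta> where "\<xi> \<noteq> 0 \<or> \<eta> \<noteq> 0 \<or> \<zeta> \<noteq> 0" "0 < a \<Longrightarrow> \<xi> = 0"
    "\<And>u v x y z. u \<noteq> 0 \<or> v \<noteq> 0 \<Longrightarrow> \<xi> * x + \<eta> * y + \<zeta> * z = 0 \<Longrightarrow> f (pt u v x y z 0) = 0"
proof -
  from assms(1) obtain s where s: "s \<in> sections a a c 1 (- a)"
    and proper: "\<not> zero_locus a a c (\<lambda>p. p Ct) \<subseteq> zero_locus a a c s"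
    and sub: "zero_locus a a c s \<inter> zero_locus a a c (\<lambda>p. p Ct) \<subseteq> zero_locus a a c f"
    unfolding contains_surface_st_def by blast
  from section_M_minus_aL[OF s assms(3)] obtain \<xi> \<eta> \<zeta> where \<xi>: "0 < a \<longrightarrow> \<xi> = 0"
    and eq: "\<And>p. p Ct = 0 \<Longrightarrow> s p = \<xi> * p Cx + \<eta> * p Cy + \<zeta> * p Cz" by blast
  show ?thesis
  proof
    show "\<xi> \<noteq> 0 \<or> \<eta> \<noteq> 0 \<or> \<zeta> \<noteq> 0"
    proof (rule ccontr)
      assume "\<not> ?thesis"
      then have "s p = 0" if "p Ct = 0" for p using eq that by simp
      then have "zero_locus a a c (\<lambda>p. p Ct) \<subseteq> zero_locus a a c s"
        by (auto simp: zero_locus_def)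
      with proper show False ..
    qed
    show "\<xi> = 0" if "0 < a" using \<xi> that by simp
    fix u v x y z :: complex
    assume uv: "u \<noteq> 0 \<or> v \<noteq> 0" and plane: "\<xi> * x + \<eta> * y + \<zeta> * z = 0"
    show "f (pt u v x y z 0) = 0"
    \<comment> \<open>The origin represents no point of the scroll, so there the vanishing comes
      from homogeneity instead of the inclusion of loci.\<close>
    proof (cases "x = 0 \<and> y = 0 \<and> z = 0")
      case True
      then show ?thesis
        using ternary_cubic_at_0[OF section_ternary_cubic[OF assms(2), of u v]] by simp
    next
      case False
      then have st: "semistable (pt u v x y z 0)" using uv by (auto simp: semistable_def)
      have "torus_orbit a a c (pt u v x y z 0) \<in> zero_locus a a c s"
        using orbit_in_zero_locus[OF s st] eq plane by simp
      moreover have "torus_orbit a a c (pt u v x y z 0) \<in> zero_locus a a c (\<lambda>p. p Ct)"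
        using orbit_in_zero_locus[OF coordinate_sections(3) st] by simp
      ultimately show ?thesis
        using sub orbit_in_zero_locus[OF assms(2) st] by blast
    qed
  qed
qed

section \<open>Binary cubics with constant coefficients, and the surfaces they force\<close>

lemma binary_cubic_root:
  assumes "binary_cubic h"
  obtains y z where "h y z = 0" "y \<noteq> 0 \<or> z \<noteq> 0"
proof -
  from assms obtain k0 k1 k2 k3
    where h: "\<And>x y. h x y = k0 * x ^ 3 + k1 * x ^ 2 * y + k2 * x * y ^ 2 + k3 * y ^ 3"
    unfolding binary_cubic_def by blast
  show ?thesis
  \<comment> \<open>Either (1, 0) is a root, or a root is found in the affine chart where the second
    coordinate is 1.\<close>
  proof (cases "k0 = 0")
    case True
    then show ?thesis by (intro that[of 1 0]) (simp_all add: h)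
  next
    case False
    then have "\<not> constant (poly [:k3, k2, k1, k0:])" by (simp add: constant_degree)
    then obtain y where "poly [:k3, k2, k1, k0:] y = 0"
      using fundamental_theorem_of_algebra by blast
    then show ?thesis
      by (intro that[of y 1]) (simp_all add: h algebra_simps power2_eq_square power3_eq_cube)
  qed
qed

lemma binary_cubic_proportional:
  assumes "binary_cubic h" "h y z = 0" "y \<noteq> 0 \<or> z \<noteq> 0" "z * y' = y * z'"
  shows "h y' z' = 0"
proof -
  obtain r where r: "y' = r * y" "z' = r * z"
  proof (cases "y = 0")
    case True
    with assms(3,4) show ?thesis by (intro that[of "z' / z"]) auto
  next
    case False
    with assms(4) show ?thesis by (intro that[of "y' / y"]) (auto simp: field_simps)
  qed
  from assms(1) obtain k0 k1 k2 k3
    where h: "\<And>x y. h x y = k0 * x ^ 3 + k1 * x ^ 2 * y + k2 * x * y ^ 2 + k3 * y ^ 3"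
    unfolding binary_cubic_def by blast
  have "h y' z' = r ^ 3 * h y z"
    unfolding h r by (simp add: algebra_simps power2_eq_square power3_eq_cube)
  with assms(2) show ?thesis by simp
qed

text \<open>Here the restriction to \<open>t = 0\<close> is a binary cubic in \<open>y, z\<close> with constant coefficients.\<close>

lemma contains_surface_st_degenerate:
  assumes f: "f \<in> sections a a c 3 (- 3 * a)" and "0 < a"
  shows "contains_surface_st a a c f"
proof -
  from f obtain S \<alpha> where S: "\<And>e. e \<in> S \<Longrightarrow> fibre_degree e = 3"
      "\<And>e. e \<in> S \<Longrightarrow> twist a a c e = - 3 * a"
    and f_eq: "f = (\<lambda>p. \<Sum>e\<in>S. \<alpha> e * power_prod e p)"
    by (rule sections_expand) blast
  have restrict: "f p = f (pt 1 0 0 (p Cy) (p Cz) 0)" if "p Ct = 0" for p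
    unfolding f_eq
  proof (rule sum.cong[OF refl])
    fix e assume e: "e \<in> S"
    show "\<alpha> e * power_prod e p = \<alpha> e * power_prod e (pt 1 0 0 (p Cy) (p Cz) 0)"
    proof (cases "e Ct = 0")
      case True
      \<comment> \<open>Degree 3 and weight -3a together give this sum of nonnegative terms, so u, v
        and x do not occur.\<close>
      have "int (e Cu) + int (e Cv) + a * int (e Cx) = 0"
      proof -
        have "int (e Cy) = 3 - int (e Cx) - int (e Cz)"
          using S(1)[OF e] True by (simp add: fibre_degree_def)
        then have "a * int (e Cy) = a * (3 - int (e Cx) - int (e Cz))" by (rule arg_cong)
        then show ?thesis
          using S(2)[OF e] True by (simp add: twist_def algebra_simps)
      qed
      moreover have "0 \<le> a * int (e Cx)" using \<open>0 < a\<close> by simp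
      ultimately have "e Cu = 0" "e Cv = 0" "a * int (e Cx) = 0" by linarith+
      with \<open>0 < a\<close> True show ?thesis by (simp add: power_prod_expand)
    qed (use that in \<open>simp add: power_prod_expand power_0_left\<close>)
  qed
  have cubic: "binary_cubic (\<lambda>y z. f (pt 1 0 0 y z 0))"
    using ternary_cubic_restrict_x[OF section_ternary_cubic[OF f]] .
  then obtain y z where yz: "f (pt 1 0 0 y z 0) = 0" "y \<noteq> 0 \<or> z \<noteq> 0"
    by (rule binary_cubic_root)
  \<comment> \<open>The linear form vanishing exactly at the root (y, z), up to scaling.\<close>
  define s where "s = (\<lambda>p :: coord \<Rightarrow> complex. z * p Cy + (- y) * p Cz)"
  have s: "s \<in> sections a a c 1 (- a)"
    unfolding s_def by (intro sections_add sections_scale coordinate_sections)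
  show ?thesis
    unfolding contains_surface_st_def
  proof (intro bexI[OF _ s] conjI)
    obtain y' z' where yz': "y' \<noteq> 0 \<or> z' \<noteq> 0" "z * y' + (- y) * z' \<noteq> 0"
      using yz(2) by (metis add.right_neutral add_0 mult_1_right mult_zero_right neg_equal_0_iff_equal zero_neq_one)
    have st: "semistable (pt 1 0 0 y' z' 0)" using yz' by (auto simp: semistable_def)
    show "\<not> zero_locus a a c (\<lambda>p. p Ct) \<subseteq> zero_locus a a c s"
      using orbit_in_zero_locus[OF coordinate_sections(3) st, of a a c]
        orbit_in_zero_locus[OF s st] yz'(2) by (auto simp: s_def)
    have "f p = 0" if "s p = 0" "p Ct = 0" for p
    proof -
      have "f p = f (pt 1 0 0 (p Cy) (p Cz) 0)" by (rule restrict) (rule that(2))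
      also have "\<dots> = 0"
        by (rule binary_cubic_proportional[OF cubic yz]) (use that(1) in \<open>simp add: s_def\<close>)
      finally show ?thesis .
    qed
    then show "zero_locus a a c s \<inter> zero_locus a a c (\<lambda>p. p Ct) \<subseteq> zero_locus a a c f"
      by (auto simp: zero_locus_def)
  qed
qed

text \<open>A common constant factor of \<open>f\<close> on \<open>t = 0\<close> gives a common root of the binary cubics at
  \<open>(u, v) = (1, 0)\<close> and \<open>(0, 1)\<close>.\<close>

lemma general_member_no_surface_pos:
  assumes "0 < a" "0 < n + 3 * a"
  shows "general_member a a c 3 n (\<lambda>f. \<not> contains_surface_st a a c f)"
proof -
  define G where "G f = cubic_resultant (\<lambda>y z. f (pt 1 0 0 y z 0)) (\<lambda>y z. f (pt 0 1 0 y z 0))"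
    for f :: "(coord \<Rightarrow> complex) \<Rightarrow> complex"
  obtain d where "form_on (sections a a c 3 n) d G"
    unfolding G_def by (rule form_on_cubic_resultant) (rule form_on_eval)+
  moreover
  define m where "m = nat (n + 3 * a)"
  have m: "int m = n + 3 * a" "m \<noteq> 0" using assms by (auto simp: m_def)
  \<comment> \<open>The witness u^m y^3 + v^m z^3 restricts to y^3 and z^3 at the two points, which
    have no common root; m > 0 makes the other term vanish.\<close>
  define f where "f = (\<lambda>p :: coord \<Rightarrow> complex. p Cu ^ m * p Cv ^ 0 * p Cx ^ 0 * p Cy ^ 3 * p Cz ^ 0 * p Ct ^ 0
    + p Cu ^ 0 * p Cv ^ m * p Cx ^ 0 * p Cy ^ 0 * p Cz ^ 3 * p Ct ^ 0)"
  have "f \<in> sections a a c 3 n"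
    unfolding f_def using m by (intro sections_add monomial_in_sections) auto
  moreover have "G f \<noteq> 0"
    using m(2) by (simp add: G_def f_def cubic_resultant_def bracket_def det3_def
        numeral_2_eq_2 numeral_3_eq_3 power_0_left)
  moreover have "\<not> contains_surface_st a a c f" if f: "f \<in> sections a a c 3 n" and "G f \<noteq> 0" for f
  proof
    assume "contains_surface_st a a c f"
    then obtain \<xi> \<eta> \<zeta> where nz: "\<xi> \<noteq> 0 \<or> \<eta> \<noteq> 0 \<or> \<zeta> \<noteq> 0" "0 < a \<Longrightarrow> \<xi> = 0"
      and van: "\<And>u v x y z. u \<noteq> 0 \<or> v \<noteq> 0 \<Longrightarrow> \<xi> * x + \<eta> * y + \<zeta> * z = 0 \<Longrightarrow> f (pt u v x y z 0) = 0"
      using f assms(1) by (elim contains_surface_st_plane) auto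
    have "cubic_resultant (\<lambda>y z. f (pt 1 0 0 y z 0)) (\<lambda>y z. f (pt 0 1 0 y z 0)) = 0"
      using nz assms(1)
      \<comment> \<open>Since a > 0 forces \<xi> = 0, the point (\<zeta>, -\<eta>) is a root of the
        linear form, independent of u and v.\<close>
      by (intro cubic_resultant_eq_0[where p = \<zeta> and q = "- \<eta>"]
          ternary_cubic_restrict_x[OF section_ternary_cubic[OF f]] van) auto
    with \<open>G f \<noteq> 0\<close> show False by (simp add: G_def)
  qed
  ultimately show ?thesis
    unfolding general_member_def by blast
qed

section \<open>The case a = b = 0: lines in the plane cubic over one point of the base\<close>

lemma form_on_hessian:
  assumes "\<And>x y z. form_on V e (\<lambda>f. C f x y z)"
  shows "form_on V (e + e + e) (\<lambda>f. hessian (C f) x y)"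
  unfolding hessian_def polar_def
  by (intro form_on_det3 form_on_scale form_on_diff assms)

lemma general_member_no_surface_zero:
  assumes "0 \<le> n"
  shows "general_member 0 0 c 3 n (\<lambda>f. \<not> contains_surface_st 0 0 c f)"
proof -
  define C where "C f x y z = f (pt 1 0 x y z 0)"
    for f :: "(coord \<Rightarrow> complex) \<Rightarrow> complex" and x y z
  define G where "G f = cubic_resultant (\<lambda>x y. C f x y 0) (hessian (C f))" for f
  obtain d where "form_on (sections 0 0 c 3 n) d G"
    unfolding G_def
    by (rule form_on_cubic_resultant) (unfold C_def, (rule form_on_eval form_on_hessian)+)
  moreover
  define m where "m = nat n"
  have m: "int m = n" using assms by (auto simp: m_def)
  \<comment> \<open>At (u, v) = (1, 0) and t = 0 this is x^2 y + y^2 z + x z^2. On z = 0 it becomes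
    x^2 y, while its Hessian is -8 (x^3 + y^3); they have no common root.\<close>
  define f where "f = (\<lambda>p :: coord \<Rightarrow> complex. p Cu ^ m * p Cv ^ 0 * p Cx ^ 2 * p Cy ^ 1 * p Cz ^ 0 * p Ct ^ 0
    + p Cu ^ m * p Cv ^ 0 * p Cx ^ 0 * p Cy ^ 2 * p Cz ^ 1 * p Ct ^ 0
    + p Cu ^ m * p Cv ^ 0 * p Cx ^ 1 * p Cy ^ 0 * p Cz ^ 2 * p Ct ^ 0)"
  have "f \<in> sections 0 0 c 3 n"
    unfolding f_def using m by (intro sections_add monomial_in_sections) auto
  moreover have "G f \<noteq> 0"
    by (simp add: G_def C_def f_def cubic_resultant_def bracket_def det3_def hessian_def polar_def
        numeral_2_eq_2 numeral_3_eq_3)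
  moreover have "\<not> contains_surface_st 0 0 c f" if f: "f \<in> sections 0 0 c 3 n" and "G f \<noteq> 0" for f
  proof
    assume "contains_surface_st 0 0 c f"
    then obtain \<xi> \<eta> \<zeta> where nz: "\<xi> \<noteq> 0 \<or> \<eta> \<noteq> 0 \<or> \<zeta> \<noteq> 0"
      and van: "\<And>u v x y z. u \<noteq> 0 \<or> v \<noteq> 0 \<Longrightarrow> \<xi> * x + \<eta> * y + \<zeta> * z = 0 \<Longrightarrow> f (pt u v x y z 0) = 0"
      using f by (elim contains_surface_st_plane) auto
    have "ternary_cubic (C f)"
      using section_ternary_cubic[OF f, of 1 0] by (simp add: C_def[abs_def])
    then have "G f = 0"
      unfolding G_def using nz by (rule resultant_hessian_eq_0) (simp add: C_def van)
    with \<open>G f \<noteq> 0\<close> show False ..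
  qed
  ultimately show ?thesis
    unfolding general_member_def by blast
qed

section \<open>The base locus along \<open>B\<close> and \<open>\<Gamma>\<close>\<close>

lemma surface_B_not_in_base_locus:
  assumes "0 \<le> n + 3 * a"
  shows "\<not> surface_B a b c \<subseteq> base_locus a b c 3 n"
proof -
  define m where "m = nat (n + 3 * a)"
  define f where "f = (\<lambda>p :: coord \<Rightarrow> complex. p Cu ^ m * p Cv ^ 0 * p Cx ^ 0 * p Cy ^ 3 * p Cz ^ 0 * p Ct ^ 0)"
  have f: "f \<in> sections a b c 3 n"
    unfolding f_def using assms by (intro monomial_in_sections) (auto simp: m_def)
  let ?p = "pt 1 0 0 1 0 0"
  have st: "semistable ?p" by (simp add: semistable_def)
  have "f ?p = 1" by (simp add: f_def)
  then have "f \<noteq> (\<lambda>_. 0)" by force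
  with f \<open>f ?p = 1\<close> have "torus_orbit a b c ?p \<notin> base_locus a b c 3 n"
    using orbit_in_zero_locus[OF f st] by (auto simp: base_locus_def)
  moreover have "torus_orbit a b c ?p \<in> surface_B a b c"
    using surface_B_iff[OF st] by simp
  ultimately show ?thesis by blast
qed

text \<open>A monomial free of z and t has weight at least -3a, which exceeds n.\<close>

lemma surface_B_in_base_locus:
  assumes "n + 3 * a < 0" "0 \<le> a"
  shows "surface_B a b c \<subseteq> base_locus a b c 3 n"
proof -
  have "f p = 0" if f: "f \<in> sections a b c 3 n" and p: "p Cz = 0" "p Ct = 0" for f p
  proof -
    from f obtain S \<alpha> where S: "\<And>e. e \<in> S \<Longrightarrow> fibre_degree e = 3"
        "\<And>e. e \<in> S \<Longrightarrow> twist a b c e = n"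
      and f_eq: "f = (\<lambda>p. \<Sum>e\<in>S. \<alpha> e * power_prod e p)"
      by (rule sections_expand) blast
    have "power_prod e p = 0" if e: "e \<in> S" for e
    proof (cases "e Cz = 0 \<and> e Ct = 0")
      case True
      then have "int (e Cy) \<le> 3" using S(1)[OF e] by (simp add: fibre_degree_def)
      then have "a * int (e Cy) \<le> a * 3" using assms(2) by (rule mult_left_mono)
      with S(2)[OF e] True assms show ?thesis by (simp add: twist_def)
    qed (use p in \<open>auto simp: power_prod_expand power_0_left\<close>)
    then show ?thesis by (simp add: f_eq)
  qed
  then show ?thesis
    by (auto simp: surface_B_def base_locus_def zero_locus_def)
qed

section \<open>Partial derivatives along the curve\<close>

lemma section_has_derivative:
  assumes "finite S" "f = (\<lambda>p. \<Sum>e\<in>S. \<alpha> e * power_prod e p)"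
  shows "((\<lambda>\<zeta>. f (p(i := \<zeta>))) has_field_derivative
    (\<Sum>e\<in>S. \<alpha> e * (of_nat (e i) * p i ^ (e i - 1) * (\<Prod>j\<in>UNIV - {i}. p j ^ e j)))) (at (p i))"
proof -
  have split: "power_prod e (p(i := \<zeta>)) = \<zeta> ^ e i * (\<Prod>j\<in>UNIV - {i}. p j ^ e j)" for e \<zeta>
    unfolding power_prod_def by (subst prod.remove[of _ i]) (auto intro!: prod.cong)
  \<comment> \<open>For \<open>e i = 0\<close> the truncated exponent \<open>e i - 1\<close> is
    harmless, as the factor \<open>of_nat (e i)\<close> is 0.\<close>
  show ?thesis
    unfolding assms(2) split by (auto intro!: derivative_eq_intros sum.cong)
qed

text \<open>Degree at most one in y, z, t would give weight at least -c, which exceeds n. So every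
  monomial has order at least two along the curve.\<close>

lemma singular_along_Gamma:
  assumes f: "f \<in> sections a b c 3 n" and "n + c < 0" "0 \<le> a" "a \<le> b" "b \<le> c"
  shows "curve_Gamma a b c \<subseteq> singular_points a b c f"
proof -
  from f obtain S \<alpha> where S: "finite S" "\<And>e. e \<in> S \<Longrightarrow> twist a b c e = n"
    and f_eq: "f = (\<lambda>p. \<Sum>e\<in>S. \<alpha> e * power_prod e p)"
    by (rule sections_expand) blast
  have two: "2 \<le> e Cy + e Cz + e Ct" if "e \<in> S" for e
  proof (rule ccontr)
    assume "\<not> ?thesis"
    then have "int (e Cy) + int (e Cz) + int (e Ct) \<le> 1" by simp
    then have "c * (int (e Cy) + int (e Cz) + int (e Ct)) \<le> c * 1"
      using assms by (intro mult_left_mono) auto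
    moreover have "a * int (e Cy) \<le> c * int (e Cy)" "b * int (e Cz) \<le> c * int (e Cz)"
      using assms by (auto intro: mult_right_mono)
    ultimately show False
      using S(2)[OF that] assms(2) by (simp add: twist_def distrib_left)
  qed
  have zero: "f p = 0" "deriv (\<lambda>\<zeta>. f (p(i := \<zeta>))) (p i) = 0"
    if p: "p Cy = 0" "p Cz = 0" "p Ct = 0" for p i
  proof -
    have "power_prod e p = 0" if "e \<in> S" for e
      using two[OF that] p by (auto simp: power_prod_expand power_0_left)
    then show "f p = 0" by (simp add: f_eq)
    have term0: "of_nat (e i) * p i ^ (e i - 1) * (\<Prod>j\<in>UNIV - {i}. p j ^ e j) = 0" if "e \<in> S" for e
    \<comment> \<open>After differentiation a vanishing factor remains: another of y, z, t, or
      \<open>i\<close> itself with exponent at least two.\<close>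
    proof (cases "\<exists>j\<in>{Cy, Cz, Ct} - {i}. e j \<noteq> 0")
      case True
      then obtain j where "j \<in> UNIV - {i}" "p j ^ e j = 0"
        using p by (auto simp: power_0_left)
      then have "(\<Prod>j\<in>UNIV - {i}. p j ^ e j) = 0" by (intro prod_zero) auto
      then show ?thesis by simp
    next
      case False
      with two[OF that] have "i \<in> {Cy, Cz, Ct}" "2 \<le> e i" by (cases i; auto)+
      with p show ?thesis by (auto simp: power_0_left)
    qed
    show "deriv (\<lambda>\<zeta>. f (p(i := \<zeta>))) (p i) = 0"
      unfolding DERIV_imp_deriv[OF section_has_derivative[OF S(1) f_eq]]
      by (intro sum.neutral ballI) (simp only: term0 mult_zero_right)
  qed
  show ?thesis
    using zero by (auto simp: curve_Gamma_def singular_points_def zero_locus_def)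
qed

text \<open>The section \<open>g\<close> is the coefficient of \<open>x\<^sup>2t\<close> in \<open>f\<close>.\<close>

lemma transversal_derivative:
  assumes f: "f \<in> sections a b c 3 n"
  obtains g where "g \<in> sections a b c 0 (n + c)"
    "\<And>p. p Cx = 1 \<Longrightarrow> p Cy = 0 \<Longrightarrow> p Cz = 0 \<Longrightarrow> p Ct = 0 \<Longrightarrow>
      ((\<lambda>\<zeta>. f (p(Ct := \<zeta>))) has_field_derivative g p) (at 0)"
proof -
  from f obtain S \<alpha> where S: "finite S" "\<And>e. e \<in> S \<Longrightarrow> twist a b c e = n"
      "\<And>e. e \<in> S \<Longrightarrow> fibre_degree e = 3"
    and f_eq: "f = (\<lambda>p. \<Sum>e\<in>S. \<alpha> e * power_prod e p)"
    by (rule sections_expand) blast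
  \<comment> \<open>Only terms linear in t and free of y and z contribute at such a point. Removing
    x^2 t raises their weight by c.\<close>
  define T where "T = {e\<in>S. e Ct = 1 \<and> e Cy = 0 \<and> e Cz = 0}"
  define g where "g = (\<lambda>p. \<Sum>e\<in>T. \<alpha> e * power_prod (e(Cx := 0, Ct := 0)) p)"
  have "g \<in> sections a b c 0 (n + c)"
    unfolding g_def
  proof (intro sections_sum sections_scale power_prod_in_sections)
    show "finite T" using S(1) by (simp add: T_def)
    fix e assume "e \<in> T"
    then show "twist a b c (e(Cx := 0, Ct := 0)) = n + c" "fibre_degree (e(Cx := 0, Ct := 0)) = 0"
      using S(2)[of e] by (auto simp: T_def twist_def fibre_degree_def)
  qed
  moreover have "((\<lambda>\<zeta>. f (p(Ct := \<zeta>))) has_field_derivative g p) (at 0)"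
    if p: "p Cx = 1" "p Cy = 0" "p Cz = 0" "p Ct = 0" for p
  proof -
    have U: "UNIV - {Ct} = {Cu, Cv, Cx, Cy, Cz}" by (auto simp: UNIV_coord)
    have "(\<Sum>e\<in>S. \<alpha> e * (of_nat (e Ct) * p Ct ^ (e Ct - 1) * (\<Prod>j\<in>UNIV - {Ct}. p j ^ e j))) = g p"
      unfolding g_def U using S(1) p
      by (intro sum.mono_neutral_cong_right)
        (auto simp: T_def power_prod_expand power_0_left)
    with section_has_derivative[OF S(1) f_eq, of p Ct] p(4) show ?thesis by simp
  qed
  ultimately show ?thesis by (rule that)
qed

text \<open>The coefficient of x^2 t is a form in u, v. Its value at (1, 0) is linear in the
  section, and when this is nonzero the zeros of the coefficient cut out a proper closed subset of
  the curve.\<close>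

lemma general_member_nonsingular:
  assumes "0 \<le> n + c"
  shows "general_member a b c 3 n
    (\<lambda>f. generically_on a b c (curve_Gamma a b c) (\<lambda>P. P \<notin> singular_points a b c f))"
proof -
  let ?q = "pt 1 0 1 0 0 0"
  have q: "semistable ?q" by (simp add: semistable_def)
  define G where "G f = deriv (\<lambda>\<zeta>. f (?q(Ct := \<zeta>))) 0" for f :: "(coord \<Rightarrow> complex) \<Rightarrow> complex"
  have D: "((\<lambda>\<zeta>. f (?q(Ct := \<zeta>))) has_field_derivative G f) (at 0)" if f: "f \<in> sections a b c 3 n" for f
  proof -
    from f obtain g where dg: "\<And>p. p Cx = 1 \<Longrightarrow> p Cy = 0 \<Longrightarrow> p Cz = 0 \<Longrightarrow> p Ct = 0 \<Longrightarrow>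
        ((\<lambda>\<zeta>. f (p(Ct := \<zeta>))) has_field_derivative g p) (at 0)"
      by (rule transversal_derivative) blast
    have "((\<lambda>\<zeta>. f (?q(Ct := \<zeta>))) has_field_derivative g ?q) (at 0)" by (rule dg) simp_all
    then show ?thesis unfolding G_def by (metis DERIV_imp_deriv)
  qed
  have "linear_on (sections a b c 3 n) G"
    unfolding linear_on_def
  proof (intro ballI allI)
    fix f g r s assume "f \<in> sections a b c 3 n" "g \<in> sections a b c 3 n"
    then have "((\<lambda>\<zeta>. r * f (?q(Ct := \<zeta>)) + s * g (?q(Ct := \<zeta>))) has_field_derivative
        r * G f + s * G g) (at 0)"
      by (intro DERIV_add DERIV_cmult D)
    then show "G (\<lambda>p. r * f p + s * g p) = r * G f + s * G g"
      unfolding G_def[of "\<lambda>p. r * f p + s * g p"] by (rule DERIV_imp_deriv)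
  qed
  then have "form_on (sections a b c 3 n) 1 G" by (rule form_on.linear)
  moreover
  define m where "m = nat (n + c)"
  define f where "f = (\<lambda>p :: coord \<Rightarrow> complex. p Cu ^ m * p Cv ^ 0 * p Cx ^ 2 * p Cy ^ 0 * p Cz ^ 0 * p Ct ^ 1)"
  have "f \<in> sections a b c 3 n"
    unfolding f_def using assms by (intro monomial_in_sections) (auto simp: m_def)
  moreover have "G f \<noteq> 0" by (simp add: G_def f_def)
  moreover have "generically_on a b c (curve_Gamma a b c) (\<lambda>P. P \<notin> singular_points a b c f)"
    if f: "f \<in> sections a b c 3 n" and "G f \<noteq> 0" for f
  proof -
    from f obtain g where g: "g \<in> sections a b c 0 (n + c)"
      and dg: "\<And>p. p Cx = 1 \<Longrightarrow> p Cy = 0 \<Longrightarrow> p Cz = 0 \<Longrightarrow> p Ct = 0 \<Longrightarrow>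
        ((\<lambda>\<zeta>. f (p(Ct := \<zeta>))) has_field_derivative g p) (at 0)"
      by (rule transversal_derivative) blast
    have "G f = g ?q" unfolding G_def by (intro DERIV_imp_deriv dg) simp_all
    then have "torus_orbit a b c ?q \<notin> zero_locus a b c g"
      using \<open>G f \<noteq> 0\<close> orbit_in_zero_locus[OF g q] by simp
    moreover have "torus_orbit a b c ?q \<in> curve_Gamma a b c"
      using curve_Gamma_iff[OF q] by simp
    moreover have "P \<notin> singular_points a b c f" if P: "P \<in> curve_Gamma a b c" "P \<notin> zero_locus a b c g" for P
    proof
      assume sing: "P \<in> singular_points a b c f"
      from P(1) obtain q where q: "semistable q" and P_eq: "P = torus_orbit a b c q"
        by (auto simp: curve_Gamma_def zero_locus_def scroll_eq)
      have q0: "q Cy = 0" "q Cz = 0" "q Ct = 0"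
        using P(1) curve_Gamma_iff[OF q] by (auto simp: P_eq)
      with q have "q Cx \<noteq> 0" by (simp add: semistable_def)
      from q obtain w where w: "w \<in> {Cu, Cv}" "q w \<noteq> 0" by (auto simp: semistable_def)
      \<comment> \<open>The torus element moves the representative into the chart used by
        \<open>singular_points\<close>.\<close>
      define l m where "l = 1 / q w" "m = 1 / q Cx"
      have lm: "l \<noteq> 0" "m \<noteq> 0" using w \<open>q Cx \<noteq> 0\<close> by (auto simp: l_m_def)
      define p where "p = torus_act a b c l m q"
      have "p \<in> P" unfolding P_eq torus_orbit_def p_def using lm by blast
      moreover have "p w = 1" "p Cx = 1" using w \<open>q Cx \<noteq> 0\<close> by (auto simp: p_def l_m_def)
      moreover have p0: "p Cy = 0" "p Cz = 0" "p Ct = 0" by (simp_all add: p_def q0)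
      moreover have "\<forall>w\<in>{Cu, Cv}. \<forall>s\<in>{Cx, Cy, Cz, Ct}. \<forall>p\<in>P. p w = 1 \<and> p s = 1 \<longrightarrow>
          (\<forall>i. i \<notin> {w, s} \<longrightarrow> deriv (\<lambda>\<zeta>. f (p(i := \<zeta>))) (p i) = 0)"
        using sing unfolding singular_points_def mem_Collect_eq by (rule conjunct2)
      moreover have "Ct \<notin> {w, Cx}" using w(1) by auto
      ultimately have "deriv (\<lambda>\<zeta>. f (p(Ct := \<zeta>))) (p Ct) = 0"
        using w(1) by blast
      then have "g p = 0"
        using DERIV_imp_deriv[OF dg[OF \<open>p Cx = 1\<close> p0]] p0(3) by simp
      moreover have "g p = l powi (n + c) * m powi 0 * g q"
        using g lm unfolding p_def sections_def by blast
      ultimately have "g q = 0" using lm by simp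
      then show False using P(2) orbit_in_zero_locus[OF g q] by (simp add: P_eq)
    qed
    ultimately show ?thesis
      unfolding generically_on_def using g by blast
  qed
  ultimately show ?thesis
    unfolding general_member_def by blast
qed

section \<open>Numerical form of the two conditions\<close>

lemma condition1_iff:
  assumes "n < 0" "0 \<le> a"
  shows "condition1 a b c n \<longleftrightarrow> 0 \<le> n + 3 * a \<and> (a = b \<longrightarrow> 0 < n + 3 * a)"
proof
  assume C: "condition1 a b c n"
  then have nB: "\<not> surface_B a b c \<subseteq> base_locus a b c 3 n" by (simp add: condition1_def)
  then have pos: "0 \<le> n + 3 * a" using surface_B_in_base_locus[of n a] assms(2) by fastforce
  moreover have "0 < n + 3 * a" if "a = b"
  proof (rule ccontr)
    assume "\<not> ?thesis"
    with pos have n: "n = - 3 * a" by simp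
    \<comment> \<open>A nonzero section exists because \<open>surface_B\<close> is not in the base
      locus, so a general member can be chosen.\<close>
    from nB obtain P h where "P \<in> scroll a b c" "h \<in> sections a b c 3 n" "h \<noteq> (\<lambda>_. 0)"
      by (auto simp: base_locus_def surface_B_def zero_locus_def)
    moreover have "general_member a b c 3 n (\<lambda>f. \<not> contains_surface_st a b c f)"
      using C that by (simp add: condition1_def)
    ultimately obtain f where "f \<in> sections a b c 3 n" "\<not> contains_surface_st a b c f"
      by (elim general_member_witness)
    with contains_surface_st_degenerate[of f a c] n assms(1) that show False by auto
  qed
  ultimately show "0 \<le> n + 3 * a \<and> (a = b \<longrightarrow> 0 < n + 3 * a)" by blast
next
  assume "0 \<le> n + 3 * a \<and> (a = b \<longrightarrow> 0 < n + 3 * a)"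
  then show "condition1 a b c n"
    using surface_B_not_in_base_locus general_member_no_surface_pos[of a n] assms
    by (auto simp: condition1_def)
qed

lemma condition2_iff:
  assumes "n < 0" "0 \<le> n + 3 * a" "a \<le> b" "b \<le> c"
  shows "condition2 a b c n \<longleftrightarrow> 0 \<le> n + c"
proof
  assume "condition2 a b c n"
  then have gen: "general_member a b c 3 n
      (\<lambda>f. generically_on a b c (curve_Gamma a b c) (\<lambda>P. P \<notin> singular_points a b c f))"
    using assms(1) by (simp add: condition2_def)
  from surface_B_not_in_base_locus[OF assms(2), of b c] obtain h
    where "h \<in> sections a b c 3 n" "h \<noteq> (\<lambda>_. 0)"
    by (auto simp: base_locus_def surface_B_def zero_locus_def)
  with gen obtain f where f: "f \<in> sections a b c 3 n"
    and nonsing: "generically_on a b c (curve_Gamma a b c) (\<lambda>P. P \<notin> singular_points a b c f)"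
    by (elim general_member_witness)
  from nonsing obtain P where "P \<in> curve_Gamma a b c" "P \<notin> singular_points a b c f"
    unfolding generically_on_def by blast
  moreover have "0 \<le> a" using assms(1,2) by linarith
  ultimately show "0 \<le> n + c"
    using singular_along_Gamma[OF f] assms(3,4) by (meson not_le subsetD)
qed (simp add: condition2_def general_member_nonsingular)

lemma conditions_nonneg:
  assumes "0 \<le> n"
  shows "condition1 0 0 d n \<and> condition2 0 0 d n"
  using assms surface_B_not_in_base_locus[of n 0] general_member_no_surface_zero[of n d]
  by (simp add: condition1_def condition2_def)

theorem proposition31:
  fixes n d :: int
  assumes "d \<ge> 0" and "(n, d) \<noteq> (0, 0)"
  shows "(\<exists>a b c :: int. 0 \<le> a \<and> a \<le> b \<and> b \<le> c \<and> a + b + c = d \<and>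
            condition1 a b c n \<and> condition2 a b c n) \<longleftrightarrow>
         (n > 0 \<or>
          (\<exists>k\<ge>0. n = - 3 * k \<and> d \<ge> 5 * k + 1) \<or>
          (\<exists>k\<ge>0. n = - 3 * k - 1 \<and> d \<ge> 5 * k + 3) \<or>
          (\<exists>k\<ge>0. n = - 3 * k - 2 \<and> d \<ge> 5 * k + 4))"
    (is "?L \<longleftrightarrow> ?R")
proof (cases "0 \<le> n")
  case True
  have ?L
    using conditions_nonneg[OF True, of d] assms(1)
    by (intro exI[of _ 0] exI[of _ d]) simp
  \<comment> \<open>For n = 0 the excluded pair gives d > 0, which is case (ii) with k = 0.\<close>
  moreover have ?R using True assms by fastforce
  ultimately show ?thesis by blast
next
  case False
  then have n: "n < 0" by simp
  have "?L \<longleftrightarrow> (\<exists>a b c. 0 \<le> a \<and> a \<le> b \<and> b \<le> c \<and> a + b + c = d \<and>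
      0 \<le> n + 3 * a \<and> (a = b \<longrightarrow> 0 < n + 3 * a) \<and> 0 \<le> n + c)" (is "_ \<longleftrightarrow> ?N")
    using condition1_iff[OF n] condition2_iff[OF n] by blast
  also have "?N \<longleftrightarrow> ?R"
  proof
    assume ?N
    then obtain a b c where abc: "a \<le> b" "b \<le> c" "a + b + c = d" "0 \<le> n + 3 * a"
      "a = b \<Longrightarrow> 0 < n + 3 * a" "0 \<le> n + c" by blast
    obtain k where k: "n = - 3 * k \<or> n = - 3 * k - 1 \<or> n = - 3 * k - 2"
    proof
      show "n = - 3 * (- n div 3) \<or> n = - 3 * (- n div 3) - 1 \<or> n = - 3 * (- n div 3) - 2"
        by presburger
    qed
    have "0 \<le> k" using k n by linarith
    from k show ?R
    proof (elim disjE)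
      assume k: "n = - 3 * k"
      \<comment> \<open>Here a is at least k and c at least 3k; b is at least k + 1, because
        equality of a and b would force a > k.\<close>
      have "5 * k + 1 \<le> d" using abc k by (cases "a = b") auto
      with k \<open>0 \<le> k\<close> show ?thesis by blast
    next
      assume k: "n = - 3 * k - 1"
      then have "k + 1 \<le> a" using abc(4) by simp
      then have "5 * k + 3 \<le> d" using abc(1-3,6) k by linarith
      with k \<open>0 \<le> k\<close> show ?thesis by blast
    next
      assume k: "n = - 3 * k - 2"
      then have "k + 1 \<le> a" using abc(4) by simp
      then have "5 * k + 4 \<le> d" using abc(1-3,6) k by linarith
      with k \<open>0 \<le> k\<close> show ?thesis by blast
    qed
  next
    assume ?R
    \<comment> \<open>Cases (iii) and (iv) have the common bound d + n \<ge> 2k + 2.\<close>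
    with n consider k where "0 \<le> k" "n = - 3 * k" "5 * k + 1 \<le> d"
      | k where "0 \<le> k" "n = - 3 * k - 1 \<or> n = - 3 * k - 2" "2 * k + 2 \<le> d + n"
      by (elim disjE exE conjE) (simp, force+)
    then show ?N
    proof cases
      case 1
      \<comment> \<open>Since n < 0, k is at least 1, and then c = d - 2k - 1 \<ge> 3k is at least b
        = k + 1.\<close>
      with n show ?thesis
        by (intro exI[of _ k] exI[of _ "k + 1"] exI[of _ "d - 2 * k - 1"]) auto
    next
      case 2
      \<comment> \<open>Here a = b = k + 1, where n + 3a is 2 or 1, and all the remaining degree
        goes into c.\<close>
      with n show ?thesis
        by (intro exI[of _ "k + 1"] exI[of _ "d - 2 * k - 2"]) auto
    qed
  qed
  finally show ?thesis .
qed

end
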